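(* For every binary chores instance, with an arbitrary number of agents and not necessarily normalized valuations, an allocation that is both EFX and EQX exists, and such an allocation can be computed in polynomial time.
   Context: An instance consists of agents $N=\{1,\dots,n\}$, a finite set $M$ of indivisible items, and for each agent $i$ an additive valuation $v_i:2^M\to\mathbb{R}$, i.e. $v_i(\emptyset)=0$ and $v_i(S)=\sum_{o\in S}v_i(o)$. It is a binary chores instance if $v_i(o)\in\{0,-1\}$ for all $i,o$. (Normalized would mean $v_i(M)=v_j(M)$ for all $i,j$; this is not assumed.) An allocation $A=(A_1,\dots,A_n)$ is a partition of $M$ into $n$ pairwise disjoint, possibly empty bundles with union $M$. For chores: $A$ is EFX if for all $i,j\in N$ with $A_i\ne\emptyset$ and every $c\in A_i$, $v_i(A_i\setminus\{c\})\ge v_i(A_j)$. $A$ is EQX if for all $i,j\in N$ with $A_i\neq\emptyset$ and every $c\in A_i$, $v_i(A_i\setminus\{c\})\ge v_j(A_j)$. (Zero-valued chores are included among the removable $c$.) *)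

theory Defs
  imports Complex_Main "HOL-Computational_Algebra.Polynomial" "HOL-Library.Log_Nat"
begin

section \<open>Binary chores instances, EFX and EQX\<close>

text \<open>
  Agents are \<open>1, \<dots>, n\<close>; items form a finite set of arbitrary type. Valuations and
  allocations are functions of the agent, and only their values on agents \<open>1, \<dots>, n\<close> (and, for
  valuations, on subsets of the item set) matter.
\<close>

definition additive_valuation :: "'a set \<Rightarrow> ('a set \<Rightarrow> real) \<Rightarrow> bool" where
  "additive_valuation M u \<longleftrightarrow> u {} = 0 \<and> (\<forall>S \<subseteq> M. u S = (\<Sum>c\<in>S. u {c}))"

definition chores_instance :: "nat \<Rightarrow> 'a set \<Rightarrow> (nat \<Rightarrow> 'a set \<Rightarrow> real) \<Rightarrow> bool" where
  "chores_instance n M v \<longleftrightarrow>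
     n \<ge> 1 \<and> finite M \<and>
     (\<forall>i\<in>{1..n}. additive_valuation M (v i) \<and> (\<forall>c\<in>M. v i {c} \<le> 0))"

definition binary_chores_instance :: "nat \<Rightarrow> 'a set \<Rightarrow> (nat \<Rightarrow> 'a set \<Rightarrow> real) \<Rightarrow> bool" where
  "binary_chores_instance n M v \<longleftrightarrow>
     chores_instance n M v \<and> (\<forall>i\<in>{1..n}. \<forall>c\<in>M. v i {c} \<in> {0, -1})"

definition allocation :: "nat \<Rightarrow> 'a set \<Rightarrow> (nat \<Rightarrow> 'a set) \<Rightarrow> bool" where
  "allocation n M A \<longleftrightarrow>
     (\<forall>i\<in>{1..n}. \<forall>j\<in>{1..n}. i \<noteq> j \<longrightarrow> A i \<inter> A j = {}) \<and> (\<Union>i\<in>{1..n}. A i) = M"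

definition EFX :: "nat \<Rightarrow> (nat \<Rightarrow> 'a set \<Rightarrow> real) \<Rightarrow> (nat \<Rightarrow> 'a set) \<Rightarrow> bool" where
  "EFX n v A \<longleftrightarrow>
     (\<forall>i\<in>{1..n}. \<forall>j\<in>{1..n}. A i \<noteq> {} \<longrightarrow> (\<forall>c\<in>A i. v i (A i - {c}) \<ge> v i (A j)))"

definition EQX :: "nat \<Rightarrow> (nat \<Rightarrow> 'a set \<Rightarrow> real) \<Rightarrow> (nat \<Rightarrow> 'a set) \<Rightarrow> bool" where
  "EQX n v A \<longleftrightarrow>
     (\<forall>i\<in>{1..n}. \<forall>j\<in>{1..n}. A i \<noteq> {} \<longrightarrow> (\<forall>c\<in>A i. v i (A i - {c}) \<ge> v j (A j)))"

section \<open>A machine model for polynomial time\<close>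

text \<open>
  A structured random access machine over the integers with unit-cost addition and subtraction.
  There is deliberately no multiplication or shift: each charged operation then adds at most one
  bit to the longest number in memory, so running times agree with those of Turing machines up
  to a polynomial. The memory is split into arrays; a program mentions array names only
  as literals, hence only finitely many of them, so this is no more powerful than a single
  memory with indirect addressing. A negative address is read as address 0.
\<close>

type_synonym memory = "nat \<Rightarrow> nat \<Rightarrow> int"

datatype expr = Const int | Cell nat expr | Add expr expr | Sub expr expr

datatype test = Less expr expr | Neg test | Conj test test

datatype program =
    Skip
  | Store nat expr expr
  | Seq program program
  | Cond test program program
  | While test program

fun eval :: "expr \<Rightarrow> memory \<Rightarrow> int" where
  "eval (Const k) s = k"
| "eval (Cell a e) s = s a (nat (eval e s))"
| "eval (Add e f) s = eval e s + eval f s"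
| "eval (Sub e f) s = eval e s - eval f s"

fun holds :: "test \<Rightarrow> memory \<Rightarrow> bool" where
  "holds (Less e f) s \<longleftrightarrow> eval e s < eval f s"
| "holds (Neg b) s \<longleftrightarrow> \<not> holds b s"
| "holds (Conj b d) s \<longleftrightarrow> holds b s \<and> holds d s"

fun expr_cost :: "expr \<Rightarrow> nat" where
  "expr_cost (Const k) = 1"
| "expr_cost (Cell a e) = 1 + expr_cost e"
| "expr_cost (Add e f) = 1 + expr_cost e + expr_cost f"
| "expr_cost (Sub e f) = 1 + expr_cost e + expr_cost f"

fun test_cost :: "test \<Rightarrow> nat" where
  "test_cost (Less e f) = 1 + expr_cost e + expr_cost f"
| "test_cost (Neg b) = 1 + test_cost b"
| "test_cost (Conj b d) = 1 + test_cost b + test_cost d"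

text \<open>
  \<open>exec P s t s'\<close>: started in memory \<open>s\<close>, the program \<open>P\<close> halts in memory \<open>s'\<close> after exactly
  \<open>t\<close> steps.
\<close>

inductive exec :: "program \<Rightarrow> memory \<Rightarrow> nat \<Rightarrow> memory \<Rightarrow> bool" where
  exec_Skip: "exec Skip s 1 s"
| exec_Store:
    "exec (Store a e f) s (1 + expr_cost e + expr_cost f)
       (s(a := (s a)(nat (eval e s) := eval f s)))"
| exec_Seq: "exec P s t s' \<Longrightarrow> exec Q s' t' s'' \<Longrightarrow> exec (Seq P Q) s (t + t') s''"
| exec_Cond_True: "holds b s \<Longrightarrow> exec P s t s' \<Longrightarrow> exec (Cond b P Q) s (1 + test_cost b + t) s'"
| exec_Cond_False: "\<not> holds b s \<Longrightarrow> exec Q s t s' \<Longrightarrow> exec (Cond b P Q) s (1 + test_cost b + t) s'"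
| exec_While_False: "\<not> holds b s \<Longrightarrow> exec (While b P) s (1 + test_cost b) s"
| exec_While_True:
    "holds b s \<Longrightarrow> exec P s t s' \<Longrightarrow> exec (While b P) s' t' s'' \<Longrightarrow>
     exec (While b P) s (1 + test_cost b + t + t') s''"

lemma exec_deterministic:
  "exec P s t s' \<Longrightarrow> exec P s u r \<Longrightarrow> u = t \<and> r = s'"
proof (induction arbitrary: u r rule: exec.induct)
  case (exec_Skip s)
  then show ?case by cases simp
next
  case (exec_Store a e f s)
  then show ?case by cases simp
next
  case (exec_Seq P s t s' Q t' s'')
  note IH = exec_Seq.IH
  from exec_Seq.prems show ?case
  proof cases
    case (exec_Seq t1 s1 t2)
    note run = this
    have "t1 = t \<and> s1 = s'" using IH(1) run(2) by blast
    moreover from this have "t2 = t' \<and> r = s''" using IH(2) run(3) by blast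
    ultimately show ?thesis using run(1) by simp
  qed
next
  case (exec_Cond_True b s P t s' Q)
  note IH = exec_Cond_True.IH and b = exec_Cond_True.hyps(1)
  from exec_Cond_True.prems show ?case
    by cases (use b in \<open>auto dest: IH\<close>)
next
  case (exec_Cond_False b s Q t s' P)
  note IH = exec_Cond_False.IH and b = exec_Cond_False.hyps(1)
  from exec_Cond_False.prems show ?case
    by cases (use b in \<open>auto dest: IH\<close>)
next
  case (exec_While_False b s P)
  note b = exec_While_False.hyps(1)
  from exec_While_False.prems show ?case
    by cases (use b in auto)
next
  case (exec_While_True b s P t s' t' s'')
  note IH = exec_While_True.IH and b = exec_While_True.hyps(1)
  from exec_While_True.prems show ?case
  proof cases
    case (exec_While_True t1 s1 t2)
    note run = this
    have "t1 = t \<and> s1 = s'" using IH(1) run(3) by blast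
    moreover from this have "t2 = t' \<and> r = s''" using IH(2) run(4) by blast
    ultimately show ?thesis using run(1) by simp
  qed (use b in simp)
qed

section \<open>Input and output\<close>

text \<open>The input list is placed in array 0; all other memory cells are 0.\<close>

definition initial_memory :: "int list \<Rightarrow> memory" where
  "initial_memory xs = (\<lambda>a k. if a = 0 \<and> k < length xs then xs ! k else 0)"

text \<open>Number of bits of the list: the binary digits of each entry, and one more for its sign.\<close>

definition bit_size :: "int list \<Rightarrow> nat" where
  "bit_size xs = (\<Sum>x\<leftarrow>xs. floorlog 2 (nat \<bar>x\<bar>) + 1)"

text \<open>
  An instance with items \<open>1, \<dots>, m\<close> is written as \<open>n\<close>, \<open>m\<close>, followed by the valuation matrix,
  one row of \<open>m\<close> single-item values per agent. For binary valuations these values are integers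
  already, so the floor only changes the type.
\<close>

definition encode_instance :: "nat \<Rightarrow> nat \<Rightarrow> (nat \<Rightarrow> nat set \<Rightarrow> real) \<Rightarrow> int list" where
  "encode_instance n m v =
     int n # int m # concat (map (\<lambda>i. map (\<lambda>c. \<lfloor>v i {c}\<rfloor>) [1..<Suc m]) [1..<Suc n])"

text \<open>The output is read off array 1, whose cell \<open>c\<close> names the agent receiving item \<open>c\<close>.\<close>

definition output_allocation :: "nat \<Rightarrow> memory \<Rightarrow> nat \<Rightarrow> nat set" where
  "output_allocation m s i = {c \<in> {1..m}. s 1 c = int i}"

end

theory Submission
  imports Defs
begin

declare One_nat_def [simp del]

text \<open>
  Call an item pending for a set \<open>L\<close> of agents if it is unassigned and costs every agent of \<open>L\<close>. First
  hand out the chores that cost everybody in full rounds, one per agent, until fewer than \<open>n\<close> are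
  left; this raises all costs by the same number \<open>q\<close>. Then shrink \<open>L\<close> from the set of all agents: an
  agent \<open>i\<close> that leaves \<open>L\<close> receives a pending item, while the \<open>d\<close> items free for \<open>i\<close> but for nobody
  else in \<open>L\<close> become pending. The gap \<open>g = |L| - #pending\<close> drops by \<open>d\<close>, so agents with \<open>d < g\<close> are dropped,
  which keeps \<open>g \<ge> 1\<close>.

  If no item is pending any more, every remaining item goes to an agent of \<open>L\<close> for whom it is free:
  agents of \<open>L\<close> have cost \<open>q\<close>, the others hold exactly \<open>q + 1\<close> items, and every agent values every
  bundle at cost at least \<open>q\<close>. Otherwise each agent of \<open>L\<close> ends with at least \<open>g\<close> items free for it alone
  within \<open>L\<close>. Serve agents of \<open>L\<close> with the pending items; \<open>g\<close> of them go unserved and receive items that are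
  free only for one served agent \<open>i0\<close> (the star). Now everybody has cost \<open>q + 1\<close>, and each agent
  of \<open>L\<close> sees cost at least \<open>q + 1\<close> everywhere: for \<open>i0\<close> this uses that the unserved agents also take their own
  private free items.

  Without items the program must stop at once, since then \<open>n\<close> may be exponential in the input size.
\<close>

section \<open>Bounded executions\<close>

text \<open>Total correctness with a time budget. As \<open>exec\<close> is deterministic, the
  existential describes the only halting run.\<close>

definition run :: "program \<Rightarrow> memory \<Rightarrow> nat \<Rightarrow> (memory \<Rightarrow> bool) \<Rightarrow> bool" where
  "run P s T Q \<longleftrightarrow> (\<exists>t s'. exec P s t s' \<and> t \<le> T \<and> Q s')"

lemma run_conseq:
  "run P s T Q \<Longrightarrow> T \<le> T' \<Longrightarrow> (\<And>s'. Q s' \<Longrightarrow> Q' s') \<Longrightarrow> run P s T' Q'"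
  unfolding run_def by (meson order_trans)

lemma run_Skip: "Q s \<Longrightarrow> 1 \<le> T \<Longrightarrow> run Skip s T Q"
  unfolding run_def using exec_Skip by blast

lemma run_Store:
  "Q (s(a := (s a)(nat (eval e s) := eval f s))) \<Longrightarrow> 1 + expr_cost e + expr_cost f \<le> T \<Longrightarrow>
   run (Store a e f) s T Q"
  unfolding run_def using exec_Store by blast

lemma run_Seq:
  assumes "run P s T Q" "\<And>s'. Q s' \<Longrightarrow> run P' s' T' R" "T + T' \<le> T''"
  shows "run (Seq P P') s T'' R"
proof -
  obtain t s' where 1: "exec P s t s'" "t \<le> T" "Q s'"
    using assms(1) unfolding run_def by blast
  obtain t' s'' where 2: "exec P' s' t' s''" "t' \<le> T'" "R s''"
    using assms(2)[OF 1(3)] unfolding run_def by blast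
  have "exec (Seq P P') s (t + t') s''" using 1 2 exec_Seq by blast
  moreover have "t + t' \<le> T''" using 1 2 assms(3) by simp
  ultimately show ?thesis using 2 unfolding run_def by blast
qed

text \<open>Symbolic execution: the budget is reduced by the exact cost of the assignment, so that
  chains of assignments unfold by \<open>intro\<close>.\<close>

lemma run_Store_Seq:
  assumes "run P (s(a := (s a)(nat (eval e s) := eval f s))) (T - (1 + expr_cost e + expr_cost f)) Q"
    and "1 + expr_cost e + expr_cost f \<le> T"
  shows "run (Seq (Store a e f) P) s T Q"
proof (rule run_Seq)
  show "run (Store a e f) s (1 + expr_cost e + expr_cost f)
      (\<lambda>s'. s' = s(a := (s a)(nat (eval e s) := eval f s)))"
    by (rule run_Store) auto
qed (use assms in auto)

lemma run_Cond:
  assumes "holds b s \<Longrightarrow> run P s T Q" "\<not> holds b s \<Longrightarrow> run P' s T Q" "1 + test_cost b + T \<le> T'"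
  shows "run (Cond b P P') s T' Q"
proof (cases "holds b s")
  case True
  then obtain t s' where "exec P s t s'" "t \<le> T" "Q s'"
    using assms(1) unfolding run_def by blast
  moreover from this have "exec (Cond b P P') s (1 + test_cost b + t) s'"
    using True exec_Cond_True by blast
  ultimately show ?thesis using assms(3) unfolding run_def
    by (metis add_le_cancel_left order_trans)
next
  case False
  then obtain t s' where "exec P' s t s'" "t \<le> T" "Q s'"
    using assms(2) unfolding run_def by blast
  moreover from this have "exec (Cond b P P') s (1 + test_cost b + t) s'"
    using False exec_Cond_False by blast
  ultimately show ?thesis using assms(3) unfolding run_def
    by (metis add_le_cancel_left order_trans)
qed

abbreviation Var :: "nat \<Rightarrow> expr" where
  "Var x \<equiv> Cell x (Const 0)"

abbreviation Assign :: "nat \<Rightarrow> expr \<Rightarrow> program" where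
  "Assign x e \<equiv> Store x (Const 0) e"

definition For_loop :: "nat \<Rightarrow> nat \<Rightarrow> program \<Rightarrow> program" where
  "For_loop x h P =
     While (Less (Var x) (Add (Cell 0 (Const (int h))) (Const 1)))
       (Seq P (Assign x (Add (Var x) (Const 1))))"

text \<open>The bound of the loop is an input cell: cell 0 holds the number of agents, cell 1 the
  number of items.\<close>

definition For :: "nat \<Rightarrow> nat \<Rightarrow> program \<Rightarrow> program" where
  "For x h P = Seq (Assign x (Const 1)) (For_loop x h P)"

text \<open>\<open>I k\<close> describes the memory before iteration \<open>k\<close>. By
  \<open>stable\<close> it ignores the counter array, so the increment preserves it, while the body
  has to leave the counter at \<open>k\<close>. Besides the body an iteration pays 8 for the test
  and 6 for the increment; the remaining 11 are the initial assignment and the failing test.\<close>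

lemma run_For:
  fixes s :: memory
  assumes start: "I 1 s"
    and stable: "\<And>k s y. I k s \<Longrightarrow> I k (s(x := y))"
    and bound: "\<And>k s. I k s \<Longrightarrow> s 0 h = int N"
    and body: "\<And>k s. 1 \<le> k \<Longrightarrow> k \<le> N \<Longrightarrow> I k s \<Longrightarrow> s x 0 = int k \<Longrightarrow>
                 run P s T (\<lambda>s'. s' x 0 = int k \<and> I (Suc k) s')"
    and post: "\<And>s. I (Suc N) s \<Longrightarrow> Q s"
    and time: "N * (T + 14) + 11 \<le> T'"
  shows "run (For x h P) s T' Q"
proof -
  \<comment> \<open>Induction on the number \<open>j\<close> of iterations still to come; the
    counter then stands at \<open>Suc N - j\<close>.\<close>
  have loop: "run (For_loop x h P) s (j * (T + 14) + 8) Q"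
    if "I (Suc N - j) s" "j \<le> N" "s x 0 = int (Suc N - j)" for j s
    using that
  proof (induction j arbitrary: s)
    case 0
    have "\<not> holds (Less (Var x) (Add (Cell 0 (Const (int h))) (Const 1))) s"
      using 0 bound[OF 0(1)] by simp
    from exec_While_False[OF this] show ?case
      unfolding run_def For_loop_def using post 0 by fastforce
  next
    case (Suc j)
    define k where "k = Suc N - Suc j"
    have k: "1 \<le> k" "k \<le> N" "Suc k = Suc N - j" "s x 0 = int k" "I k s"
      using Suc.prems by (auto simp: k_def)
    obtain t s1 where 1: "exec P s t s1" "t \<le> T" "s1 x 0 = int k" "I (Suc k) s1"
      using body[OF k(1,2,5,4)] unfolding run_def by blast
    define s2 where "s2 = s1(x := (s1 x)(0 := int (Suc k)))"
    have "exec (Assign x (Add (Var x) (Const 1))) s1 6 s2"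
      using exec_Store[of x "Const 0" "Add (Var x) (Const 1)" s1] 1(3)
      by (simp add: s2_def add.commute)
    note step = exec_Seq[OF 1(1) this]
    have "I (Suc N - j) s2" "s2 x 0 = int (Suc N - j)"
      using stable[OF 1(4)] k by (simp_all add: s2_def)
    then obtain t' s3 where 3: "exec (For_loop x h P) s2 t' s3" "t' \<le> j * (T + 14) + 8" "Q s3"
      using Suc.IH Suc.prems unfolding run_def by fastforce
    have "holds (Less (Var x) (Add (Cell 0 (Const (int h))) (Const 1))) s"
      using k bound[OF k(5)] by simp
    from exec_While_True[OF this step 3(1)[unfolded For_loop_def]]
    have "exec (For_loop x h P) s (14 + t + t') s3"
      unfolding For_loop_def by (simp add: algebra_simps)
    moreover have "14 + t + t' \<le> Suc j * (T + 14) + 8" using 1 3 by simp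
    ultimately show ?case using 3 unfolding run_def by blast
  qed
  have "run (For_loop x h P) (s(x := (s x)(0 := 1))) (N * (T + 14) + 8) Q"
    using loop[of N "s(x := (s x)(0 := 1))"] stable[OF start]
    by (simp add: One_nat_def)
  then show ?thesis unfolding For_def
    by (intro run_Store_Seq) (use time in \<open>auto elim!: run_conseq\<close>)
qed

text \<open>Frame condition: \<open>X\<close> lists the arrays that a piece of code may
  change.\<close>

definition same :: "nat set \<Rightarrow> memory \<Rightarrow> memory \<Rightarrow> bool" where
  "same X s s' \<longleftrightarrow> (\<forall>a. a \<notin> X \<longrightarrow> s' a = s a)"

section \<open>The algorithm\<close>

text \<open>\<open>Cover\<close> counts for each item the agents of the current set for whom it is
  free. \<open>Dropped\<close> marks the agents outside \<open>L\<close>, \<open>Served\<close>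
  those given an item when they were dropped or served, and \<open>Star\<close> is the last agent
  that \<open>serve_pass\<close> served, or 0. As all these arrays start at 0, initially no item is
  owned and nobody is marked.\<close>

abbreviation (input) "Owner \<equiv> 1 :: nat"
abbreviation (input) "Row \<equiv> 2 :: nat"
abbreviation (input) "Cover \<equiv> 3 :: nat"
abbreviation (input) "Dropped \<equiv> 4 :: nat"
abbreviation (input) "Pending \<equiv> 5 :: nat"
abbreviation (input) "Num \<equiv> 6 :: nat"
abbreviation (input) "Pick \<equiv> 7 :: nat"
abbreviation (input) "Star \<equiv> 8 :: nat"
abbreviation (input) "Served \<equiv> 9 :: nat"
abbreviation (input) "Item \<equiv> 10 :: nat"
abbreviation (input) "Agent \<equiv> 11 :: nat"
abbreviation (input) "Round \<equiv> 12 :: nat"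
abbreviation (input) "Gap \<equiv> 13 :: nat"

abbreviation "num_agents \<equiv> Cell 0 (Const 0)"
abbreviation "num_items \<equiv> Cell 0 (Const 1)"

text \<open>Values are 0 or -1, so exceeding -1 means being 0.\<close>

definition is_zero :: test where
  "is_zero = Less (Const (-1)) (Cell 0 (Add (Cell Row (Var Agent)) (Var Item)))"

definition count :: "test \<Rightarrow> program" where
  "count b = Seq (Assign Num (Const 0))
     (For Item 1 (Cond b (Assign Num (Add (Var Num) (Const 1))) Skip))"

definition adjust :: "int \<Rightarrow> program" where
  "adjust \<delta> = For Item 1 (Cond is_zero
     (Store Cover (Var Item) (Add (Cell Cover (Var Item)) (Const \<delta>))) Skip)"

text \<open>The scan keeps overwriting \<open>Pick\<close>, so the last pending item is the one
  handed out.\<close>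

definition give :: program where
  "give = Seq
     (For Item 1 (Cond
        (Conj (Less (Cell Cover (Var Item)) (Const 1)) (Less (Cell Owner (Var Item)) (Const 1)))
        (Assign Pick (Var Item)) Skip))
     (Store Owner (Var Pick) (Var Agent))"

text \<open>The value of item \<open>c\<close> for agent \<open>i\<close> is in input cell \<open>Row[i] + c\<close>. Without multiplication
  these offsets have to be accumulated; the first one, \<open>Row[0] = 1 - m\<close>, may be negative.\<close>

definition set_rows :: program where
  "set_rows = Seq (Assign Row (Sub (Const 1) num_items))
     (For Agent 0 (Store Row (Var Agent)
        (Add (Cell Row (Sub (Var Agent) (Const 1))) num_items)))"

definition rounds :: program where
  "rounds = For Round 1 (Cond (Less (Var Pending) num_agents) Skip
     (Seq (For Agent 0 give) (Assign Pending (Sub (Var Pending) num_agents))))"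

text \<open>The item is chosen while \<open>Cover\<close> still counts the agent, hence it costs
  that agent. Only then does \<open>adjust\<close> release the \<open>Num\<close> items that were
  free for this agent alone.\<close>

definition drop_agent :: program where
  "drop_agent = Seq give (Seq (adjust (-1))
     (Seq (Store Dropped (Var Agent) (Const 1))
     (Seq (Store Served (Var Agent) (Const 1))
     (Seq (Assign Pending (Sub (Add (Var Pending) (Var Num)) (Const 1)))
          (Assign Gap (Sub (Var Gap) (Var Num)))))))"

definition drop_pass :: program where
  "drop_pass = For Agent 0 (Cond (Less (Const 0) (Var Pending))
     (Seq (count (Conj is_zero (Less (Cell Cover (Var Item)) (Const 2))))
       (Cond (Less (Var Num) (Var Gap)) drop_agent Skip))
     Skip)"

definition serve_pass :: program where
  "serve_pass = For Agent 0
     (Cond (Conj (Less (Const 0) (Var Pending)) (Less (Cell Dropped (Var Agent)) (Const 1)))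
       (Seq give
         (Seq (Store Served (Var Agent) (Const 1))
         (Seq (Assign Pending (Sub (Var Pending) (Const 1)))
              (Assign Star (Var Agent)))))
       Skip)"

text \<open>Taking the star agent out of \<open>Cover\<close> makes the items free for it alone look
  pending to \<open>give\<close>, which passes them to the unserved agents.\<close>

definition star_pass :: program where
  "star_pass = Cond (Less (Const 0) (Var Star))
     (Seq (Assign Agent (Var Star)) (Seq (adjust (-1))
       (For Agent 0 (Cond (Less (Cell Served (Var Agent)) (Const 1)) give Skip))))
     Skip"

definition final_pass :: program where
  "final_pass = For Item 1 (Cond (Less (Cell Owner (Var Item)) (Const 1))
     (For Agent 0 (Cond (Conj (Less (Cell Dropped (Var Agent)) (Const 1)) is_zero)
       (Store Owner (Var Item) (Var Agent)) Skip))
     Skip)"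

definition passes :: program where
  "passes = Seq drop_pass (Seq serve_pass (Seq star_pass final_pass))"

definition allocate :: program where
  "allocate = Seq rounds (Seq (Assign Gap (Sub num_agents (Var Pending))) passes)"

definition chores_program :: program where
  "chores_program = Cond (Less (Const 0) num_items)
     (Seq set_rows (Seq (For Agent 0 (adjust 1))
     (Seq (count (Less (Cell Cover (Var Item)) (Const 1)))
     (Seq (Assign Pending (Var Num)) allocate))))
     Skip"

section \<open>Valuations as counts of costly items\<close>

locale binary_chores =
  fixes n m :: nat and v :: "nat \<Rightarrow> nat set \<Rightarrow> real"
  assumes binary: "binary_chores_instance n {1..m} v"
begin

definition zero :: "nat \<Rightarrow> nat \<Rightarrow> bool" where
  "zero i c \<longleftrightarrow> v i {c} = 0"

definition cost :: "nat \<Rightarrow> nat set \<Rightarrow> nat" where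
  "cost i S = card {c \<in> S. \<not> zero i c}"

lemma n_pos: "1 \<le> n"
  using binary by (simp add: binary_chores_instance_def chores_instance_def)

text \<open>Turns the fairness conditions on real values into inequalities between
  cardinalities.\<close>

lemma value_eq_cost:
  assumes "i \<in> {1..n}" "S \<subseteq> {1..m}"
  shows "v i S = - real (cost i S)"
proof -
  have fin: "finite S" using assms(2) finite_subset by blast
  have "v i S = (\<Sum>c\<in>S. v i {c})"
    using binary assms
    by (auto simp: binary_chores_instance_def chores_instance_def additive_valuation_def)
  also have "\<dots> = (\<Sum>c\<in>S. if \<not> zero i c then -1 else 0)"
  proof (rule sum.cong[OF refl])
    fix c assume "c \<in> S"
    then have "c \<in> {1..m}" using assms by blast
    then have "v i {c} \<in> {0, -1}"
      using binary assms unfolding binary_chores_instance_def by blast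
    then show "v i {c} = (if \<not> zero i c then -1 else 0)" by (auto simp: zero_def)
  qed
  also have "\<dots> = - real (cost i S)"
    using fin by (simp add: cost_def sum.If_cases Int_def)
  finally show ?thesis .
qed

section \<open>Partial allocations\<close>

text \<open>An owner map sends items to agents; the value 0 means that the item is unassigned.\<close>

definition share :: "(nat \<Rightarrow> int) \<Rightarrow> nat \<Rightarrow> nat set" where
  "share a i = {c \<in> {1..m}. a c = int i}"

definition pend :: "(nat \<Rightarrow> int) \<Rightarrow> nat set \<Rightarrow> nat set" where
  "pend a L = {c \<in> {1..m}. a c = 0 \<and> (\<forall>i\<in>L. \<not> zero i c)}"

definition sole :: "nat set \<Rightarrow> nat \<Rightarrow> nat set" where
  "sole L i = {c \<in> {1..m}. zero i c \<and> (\<forall>j\<in>L - {i}. \<not> zero j c)}"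

text \<open>The state of a partial allocation at level \<open>q\<close>: only items costing their
  owner and all of \<open>L\<close> have been handed out, the agents of \<open>F\<close> are one
  item ahead, and the full rounds guarantee that everybody sees cost at least \<open>q\<close> in
  every bundle.\<close>

definition partial :: "nat \<Rightarrow> nat set \<Rightarrow> nat set \<Rightarrow> (nat \<Rightarrow> int) \<Rightarrow> bool" where
  "partial q L F a \<longleftrightarrow>
     (\<forall>c\<in>{1..m}. a c \<in> int ` {0..n}) \<and>
     (\<forall>c\<in>{1..m}. a c \<noteq> 0 \<longrightarrow> \<not> zero (nat (a c)) c \<and> (\<forall>i\<in>L. \<not> zero i c)) \<and>
     (\<forall>i\<in>{1..n}. card (share a i) = (if i \<in> F then Suc q else q)) \<and>
     (\<forall>i\<in>{1..n}. \<forall>j\<in>{1..n}. q \<le> cost i (share a j))"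

lemma finite_share [simp]: "finite (share a i)"
  by (simp add: share_def)

lemma finite_pend [simp]: "finite (pend a L)"
  by (simp add: pend_def)

lemma finite_sole [simp]: "finite (sole L i)"
  by (simp add: sole_def)

lemma cost_mono: "S \<subseteq> T \<Longrightarrow> finite T \<Longrightarrow> cost i S \<le> cost i T"
  unfolding cost_def by (rule card_mono) auto

lemma cost_le_card: "finite S \<Longrightarrow> cost i S \<le> card S"
  unfolding cost_def by (rule card_mono) auto

lemma cost_eq_card: "(\<And>c. c \<in> S \<Longrightarrow> \<not> zero i c) \<Longrightarrow> cost i S = card S"
  unfolding cost_def by (metis (mono_tags, lifting) Collect_cong Collect_mem_eq)

lemma share_give:
  assumes "c \<in> {1..m}" "a c = 0" "j \<ge> 1"
  shows "share (a(c := int i)) j = (if j = i then insert c (share a j) else share a j)"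
  using assms by (auto simp: share_def)

lemma pend_give: "i \<ge> 1 \<Longrightarrow> pend (a(c := int i)) L = pend a L - {c}"
  by (auto simp: pend_def)

lemma partial_give:
  assumes p: "partial q L F a" and c: "c \<in> pend a L" "\<not> zero i c" and i: "i \<in> {1..n}" "i \<notin> F"
  shows "partial q L (insert i F) (a(c := int i))"
proof -
  have c': "c \<in> {1..m}" "a c = 0" "\<forall>i\<in>L. \<not> zero i c" using c by (auto simp: pend_def)
  have b: "share (a(c := int i)) j = (if j = i then insert c (share a j) else share a j)"
    if "j \<in> {1..n}" for j
    using share_give[of c a j i, OF c'(1,2)] i that by simp
  have new: "c \<notin> share a i" using c' i by (simp add: share_def)
  have "card (share (a(c := int i)) j) = (if j \<in> insert i F then Suc q else q)"
    if "j \<in> {1..n}" for j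
    using b[OF that] p i that new by (auto simp: partial_def)
  moreover have "q \<le> cost k (share (a(c := int i)) j)" if "k \<in> {1..n}" "j \<in> {1..n}" for k j
  proof -
    have "q \<le> cost k (share a j)" using p that by (simp add: partial_def)
    also have "\<dots> \<le> cost k (share (a(c := int i)) j)"
      by (rule cost_mono) (use b[OF that(2)] in auto)
    finally show ?thesis .
  qed
  ultimately show ?thesis
    using p c c' i unfolding partial_def by (auto simp del: share_def)
qed

lemma partial_costly:
  assumes p: "partial q L F a" and c: "c \<in> share a j" "j \<ge> 1"
  shows "\<not> zero j c" "i \<in> L \<Longrightarrow> \<not> zero i c"
proof -
  have "c \<in> {1..m}" "a c = int j" "a c \<noteq> 0" using c by (auto simp: share_def)
  then have "\<not> zero (nat (a c)) c \<and> (\<forall>i\<in>L. \<not> zero i c)"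
    using p unfolding partial_def by blast
  then show "\<not> zero j c" "i \<in> L \<Longrightarrow> \<not> zero i c" using \<open>a c = int j\<close> by auto
qed

lemma partial_antimono: "partial q L F a \<Longrightarrow> L' \<subseteq> L \<Longrightarrow> partial q L' F a"
  unfolding partial_def by blast

text \<open>While \<open>L\<close> is the set of all agents, every assigned item costs everybody.
  All costs are therefore bundle sizes, and these have all reached \<open>Suc q\<close>.\<close>

lemma partial_round:
  assumes "partial q {1..n} {1..n} a"
  shows "partial (Suc q) {1..n} {} a"
proof -
  have "Suc q \<le> cost i (share a j)" if ij: "i \<in> {1..n}" "j \<in> {1..n}" for i j
  proof -
    have "cost i (share a j) = card (share a j)"
      by (rule cost_eq_card) (use partial_costly(2)[OF assms] ij in auto)
    then show ?thesis using assms ij by (simp add: partial_def)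
  qed
  then show ?thesis using assms by (simp add: partial_def)
qed

lemma sole_unassigned: "partial q L F a \<Longrightarrow> i \<in> L \<Longrightarrow> c \<in> sole L i \<Longrightarrow> a c = 0"
  by (auto simp: partial_def sole_def)

text \<open>The items that become pending are those whose only free agent in \<open>L\<close> was
  \<open>i\<close>. None of them is assigned yet, because \<open>partial\<close> hands out only
  items that cost all of \<open>L\<close>.\<close>

lemma pend_remove:
  assumes "partial q L F a" "i \<in> L"
  shows "pend a (L - {i}) = pend a L \<union> sole L i" "pend a L \<inter> sole L i = {}"
  using assms sole_unassigned[OF assms] by (auto simp: pend_def sole_def)

section \<open>Complete allocations\<close>

text \<open>Which agent of \<open>L\<close> takes a free item is left open, so correctness does not
  depend on the choice made by the final pass.\<close>

definition complete_by :: "nat set \<Rightarrow> (nat \<Rightarrow> int) \<Rightarrow> (nat \<Rightarrow> int) \<Rightarrow> bool" where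
  "complete_by L a a' \<longleftrightarrow> (\<forall>c\<in>{1..m}.
     if a c \<noteq> 0 then a' c = a c else (\<exists>j\<in>L. zero j c \<and> a' c = int j))"

lemma complete_byD:
  assumes "complete_by L a a'" "c \<in> {1..m}"
  shows "a c \<noteq> 0 \<Longrightarrow> a' c = a c" "a c = 0 \<Longrightarrow> \<exists>j\<in>L. zero j c \<and> a' c = int j"
  using assms unfolding complete_by_def by (metis (no_types))+

definition solution :: "(nat \<Rightarrow> int) \<Rightarrow> bool" where
  "solution a \<longleftrightarrow>
     allocation n {1..m} (share a) \<and> EFX n v (share a) \<and> EQX n v (share a)"

text \<open>In terms of costs, EFX and EQX both follow from one threshold \<open>t\<close> per agent
  that separates its own cost after any removal from the costs of the other bundles, as seen by
  itself and by their owners.\<close>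

lemma solutionI:
  assumes range: "\<And>c. c \<in> {1..m} \<Longrightarrow> a c \<in> int ` {1..n}"
    and level: "\<And>i. i \<in> {1..n} \<Longrightarrow> \<exists>t. (\<forall>c\<in>share a i. cost i (share a i - {c}) \<le> t) \<and>
      (\<forall>j\<in>{1..n}. t \<le> cost i (share a j) \<and> t \<le> cost j (share a j))"
  shows "solution a"
proof -
  have val: "v i (share a j) = - real (cost i (share a j))"
    "v i (share a j - {c}) = - real (cost i (share a j - {c}))" if "i \<in> {1..n}" for i j c
    by (rule value_eq_cost[OF that]; auto simp: share_def)+
  have "allocation n {1..m} (share a)"
    unfolding allocation_def using range by (fastforce simp: share_def)
  moreover have "cost i (share a i - {c}) \<le> cost i (share a j)"
    "cost i (share a i - {c}) \<le> cost j (share a j)"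
    if "i \<in> {1..n}" "j \<in> {1..n}" "c \<in> share a i" for i j c
    using level[OF that(1)] that(2,3) order_trans by blast+
  ultimately show ?thesis
    unfolding solution_def EFX_def EQX_def using val by auto
qed

text \<open>\<open>a\<close> is known to assign only items costing all of \<open>L'\<close>, whereas
  \<open>L\<close> takes the free items on completion. The two sets differ in the star case, where
  \<open>L' = L - {i0}\<close>.\<close>

context
  fixes q :: nat and L :: "nat set" and L' :: "nat set" and F :: "nat set" and a :: "nat \<Rightarrow> int" and a' :: "nat \<Rightarrow> int"
  assumes p: "partial q L' F a" and L: "L' \<subseteq> L" "L \<subseteq> {1..n}" and cb: "complete_by L a a'"
begin

lemma complete_range:
  assumes c: "c \<in> {1..m}"
  shows "a' c \<in> int ` {1..n}"
proof (cases "a c = 0")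
  case True
  then show ?thesis using complete_byD(2)[OF cb c] L by blast
next
  case False
  moreover have "a c \<in> int ` {0..n}" using c p unfolding partial_def by blast
  ultimately show ?thesis using complete_byD(1)[OF cb c] by force
qed

lemma mem_share_complete:
  assumes "j \<in> {1..n}"
  shows "c \<in> share a j \<Longrightarrow> c \<in> share a' j"
    and "c \<in> share a' j \<Longrightarrow> c \<in> share a j \<or> j \<in> L \<and> zero j c"
proof -
  show "c \<in> share a' j" if "c \<in> share a j"
    using complete_byD(1)[OF cb, of c] that assms by (simp add: share_def)
  assume c: "c \<in> share a' j"
  show "c \<in> share a j \<or> j \<in> L \<and> zero j c"
  proof (cases "a c = 0")
    case True
    then show ?thesis using complete_byD(2)[OF cb, of c] c by (auto simp: share_def)
  next
    case False
    then show ?thesis using complete_byD(1)[OF cb, of c] c by (auto simp: share_def)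
  qed
qed

lemma share_complete: "j \<in> {1..n} \<Longrightarrow> share a j \<subseteq> share a' j"
  using mem_share_complete by blast

lemma share_complete_outside: "j \<in> {1..n} \<Longrightarrow> j \<notin> L \<Longrightarrow> share a' j = share a j"
  using mem_share_complete by blast

lemma cost_complete_mono: "j \<in> {1..n} \<Longrightarrow> cost i (share a j) \<le> cost i (share a' j)"
  by (intro cost_mono share_complete) auto

text \<open>Items added by the completion are free for their recipient, and all earlier items cost
  their owner.\<close>

lemma cost_complete_own:
  assumes j: "j \<in> {1..n}"
  shows "cost j (share a' j) = card (share a j)"
proof -
  have "{c \<in> share a' j. \<not> zero j c} = {c \<in> share a j. \<not> zero j c}"
    using mem_share_complete[OF j] by blast
  then have "cost j (share a' j) = cost j (share a j)" by (simp add: cost_def)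
  also have "\<dots> = card (share a j)"
    by (rule cost_eq_card) (use partial_costly(1)[OF p] j in auto)
  finally show ?thesis .
qed

text \<open>The threshold is \<open>q\<close>. An agent of \<open>L\<close> outside \<open>F\<close>
  has cost exactly \<open>q\<close>, even before a removal. An agent outside \<open>L\<close> gains
  nothing and holds at most \<open>q + 1\<close> items, so one removal brings it down to
  \<open>q\<close>.\<close>

lemma low_level:
  assumes "i \<in> {1..n}" and small: "i \<in> L \<Longrightarrow> i \<notin> F"
  shows "\<exists>t. (\<forall>c\<in>share a' i. cost i (share a' i - {c}) \<le> t) \<and>
    (\<forall>j\<in>{1..n}. t \<le> cost i (share a' j) \<and> t \<le> cost j (share a' j))"
proof (intro exI[of _ q] conjI ballI)
  fix c assume c: "c \<in> share a' i"
  show "cost i (share a' i - {c}) \<le> q"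
  proof (cases "i \<in> L")
    case True
    have "cost i (share a' i - {c}) \<le> cost i (share a' i)" by (rule cost_mono) auto
    also have "\<dots> = q" using small[OF True] cost_complete_own p assms(1) by (simp add: partial_def)
    finally show ?thesis .
  next
    case False
    have "cost i (share a' i - {c}) \<le> card (share a' i - {c})" by (rule cost_le_card) simp
    also have "\<dots> = card (share a i) - 1"
      using c share_complete_outside[OF assms(1) False] by simp
    also have "\<dots> \<le> q" using p assms(1) by (simp add: partial_def)
    finally show ?thesis .
  qed
next
  fix j assume j: "j \<in> {1..n}"
  show "q \<le> cost i (share a' j)" "q \<le> cost j (share a' j)"
    using cost_complete_mono[OF j] p assms(1) j unfolding partial_def by (meson order_trans)+
qed

end

lemma solution_low:
  assumes "partial q L ({1..n} - L) a" "L \<subseteq> {1..n}" "complete_by L a a'"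
  shows "solution a'"
  by (rule solutionI)
    (use complete_range[OF assms(1) _ assms(2,3)] low_level[OF assms(1) _ assms(2,3)] in auto)

text \<open>Some agents of \<open>L\<close> may hold, besides universally assigned chores, only an item that is free for
  \<open>i0\<close>. The free items they receive on completion make their bundles costly enough for \<open>i0\<close>.\<close>

lemma solution_high:
  assumes p: "partial q (L - {i0}) {1..n} a" and L: "L \<subseteq> {1..n}" "i0 \<in> L"
    and cb: "complete_by L a a'"
    and star: "\<And>j. j \<in> {1..n} \<Longrightarrow>
      Suc q \<le> cost i0 (share a j) \<or> (j \<in> L - {i0} \<and> q \<le> cost i0 (share a j) \<and> sole L j \<noteq> {})"
  shows "solution a'"
proof (rule solutionI)
  show "a' c \<in> int ` {1..n}" if "c \<in> {1..m}" for c
    using complete_range[OF p _ L(1) cb that] by auto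
next
  fix i assume i: "i \<in> {1..n}"
  show "\<exists>t. (\<forall>c\<in>share a' i. cost i (share a' i - {c}) \<le> t) \<and>
    (\<forall>j\<in>{1..n}. t \<le> cost i (share a' j) \<and> t \<le> cost j (share a' j))"
  proof (cases "i \<in> L")
    \<comment> \<open>Agents outside \<open>L\<close> keep the lower threshold \<open>q\<close>; the
      agents of \<open>L\<close> below need \<open>Suc q\<close>, which is their own cost.\<close>
    case False
    then show ?thesis using low_level[OF p _ L(1) cb i] by auto
  next
    case True
    have own: "cost j (share a' j) = Suc q" if "j \<in> {1..n}" for j
      using cost_complete_own[OF p _ L(1) cb that] p that by (auto simp: partial_def)
    have other: "Suc q \<le> cost i (share a' j)" if j: "j \<in> {1..n}" for j
    proof -
      have mono: "cost i (share a j) \<le> cost i (share a' j)"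
        using cost_complete_mono[OF p _ L(1) cb j] by auto
      consider "i \<noteq> i0" | "Suc q \<le> cost i (share a j)"
        | "i = i0" "j \<in> L - {i0}" "q \<le> cost i0 (share a j)" "sole L j \<noteq> {}"
        using star[OF j] by blast
      then show ?thesis
      proof cases
        case 1
        have "cost i (share a j) = card (share a j)"
          by (rule cost_eq_card) (use partial_costly(2)[OF p] 1 True j in auto)
        then show ?thesis using mono p j by (simp add: partial_def)
      next
        case 2
        then show ?thesis using mono by simp
      next
        case 3
        \<comment> \<open>The completion must give \<open>c\<close> to an agent of \<open>L\<close>
          for whom it is free, and \<open>j\<close> is the only one. As \<open>c\<close> costs
          \<open>i0\<close>, it supplies the missing unit of cost.\<close>
        obtain c where c: "c \<in> sole L j" using 3 by blast
        have z: "a c = 0" using p 3 c by (auto simp: partial_def sole_def)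
        have "c \<in> {1..m}" using c by (simp add: sole_def)
        then have "c \<in> share a' j"
          using complete_byD(2)[OF cb _ z] c by (auto simp: sole_def share_def)
        moreover have "share a j \<subseteq> share a' j"
          using share_complete[OF p _ L(1) cb j] by auto
        moreover have nz: "\<not> zero i c" using c 3 L by (auto simp: sole_def)
        ultimately have "insert c {c \<in> share a j. \<not> zero i c} \<subseteq> {c \<in> share a' j. \<not> zero i c}"
          by auto
        then have "card (insert c {c \<in> share a j. \<not> zero i c}) \<le> cost i (share a' j)"
          unfolding cost_def by (rule card_mono[rotated]) simp
        moreover have "c \<notin> share a j" using z j by (auto simp: share_def)
        ultimately have "Suc (cost i (share a j)) \<le> cost i (share a' j)"
          by (simp add: cost_def)
        then show ?thesis using 3 by simp
      qed
    qed
    have "cost i (share a' i - {c}) \<le> Suc q" for c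
      using own[OF i] cost_mono[of "share a' i - {c}" "share a' i" i] by auto
    then show ?thesis using own other by (intro exI[of _ "Suc q"]) auto
  qed
qed

section \<open>Correctness of the subprograms\<close>

text \<open>\<open>f\<close> and \<open>r\<close> stand for array 0 and the array
  \<open>Row\<close>; the program never writes array 0.\<close>

definition input_ok :: "(nat \<Rightarrow> int) \<Rightarrow> (nat \<Rightarrow> int) \<Rightarrow> bool" where
  "input_ok f r \<longleftrightarrow> f 0 = int n \<and> f 1 = int m \<and>
     (\<forall>i\<in>{1..n}. \<forall>c\<in>{1..m}. f (nat (r i + int c)) = (if zero i c then 0 else -1))"

lemma input_okD: "input_ok f r \<Longrightarrow> f 0 = int n" "input_ok f r \<Longrightarrow> f 1 = int m"
  by (auto simp: input_ok_def)

lemma holds_is_zero: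
  assumes "input_ok (s 0) (s Row)" "s Agent 0 = int i" "s Item 0 = int c"
    and "i \<in> {1..n}" "c \<in> {1..m}"
  shows "holds is_zero s \<longleftrightarrow> zero i c"
  using assms by (auto simp: is_zero_def input_ok_def)

lemma test_cost_is_zero: "test_cost is_zero = 9"
  by (simp add: is_zero_def)

lemma run_count:
  assumes m: "s 0 1 = int m"
    and test: "\<And>s' c. c \<in> {1..m} \<Longrightarrow> same {Num, Item} s s' \<Longrightarrow> s' Item 0 = int c \<Longrightarrow>
      holds b s' \<longleftrightarrow> B c"
    and time: "m * (test_cost b + 21) + 14 \<le> T"
  shows "run (count b) s T (\<lambda>s'. same {Num, Item} s s' \<and> s' Num 0 = int (card {c \<in> {1..m}. B c}))"
  unfolding count_def
proof (rule run_Store_Seq)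
  define I where "I k s' \<longleftrightarrow> same {Num, Item} s s' \<and> s' Num 0 = int (card {c \<in> {1..<k}. B c})"
    for k :: nat and s'
  have step: "card {c \<in> {1..<Suc k}. B c} = card {c \<in> {1..<k}. B c} + (if B k then 1 else 0)"
    if "1 \<le> k" for k
  proof -
    have "{c \<in> {1..<Suc k}. B c} = {c \<in> {1..<k}. B c} \<union> (if B k then {k} else {})"
      using that by (auto simp: less_Suc_eq)
    then show ?thesis by simp
  qed
  show "run (For Item 1 (Cond b (Assign Num (Add (Var Num) (Const 1))) Skip))
      (s(Num := (s Num)(nat (eval (Const 0) s) := eval (Const 0) s)))
      (T - (1 + expr_cost (Const 0) + expr_cost (Const 0)))
      (\<lambda>s'. same {Num, Item} s s' \<and> s' Num 0 = int (card {c \<in> {1..m}. B c}))"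
  proof (rule run_For[where I = I and N = m and T = "test_cost b + 7"])
    fix k s' assume k: "1 \<le> k" "k \<le> m" "I k s'" "s' Item 0 = int k"
    have "holds b s' \<longleftrightarrow> B k" using test k by (auto simp: I_def)
    then show "run (Cond b (Assign Num (Add (Var Num) (Const 1))) Skip) s' (test_cost b + 7)
        (\<lambda>s'. s' Item 0 = int k \<and> I (Suc k) s')"
      by (intro run_Cond[where T = 6] run_Store run_Skip)
        (use k step[OF k(1)] in \<open>auto simp: I_def same_def\<close>)
  qed (use m time in \<open>auto simp: I_def same_def add.commute atLeastLessThanSuc_atLeastAtMost\<close>)
qed (use time in auto)

lemma run_adjust:
  assumes ok: "input_ok (s 0) (s Row)" and i: "s Agent 0 = int i" "i \<in> {1..n}"
    and time: "m * 32 + 11 \<le> T"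
  shows "run (adjust \<delta>) s T (\<lambda>s'. same {Cover, Item} s s' \<and>
    (\<forall>c\<in>{1..m}. s' Cover c = s Cover c + (if zero i c then \<delta> else 0)))"
  unfolding adjust_def
proof (rule run_For[where N = m and T = 18 and
      I = "\<lambda>k s'. same {Cover, Item} s s' \<and>
        (\<forall>c\<in>{1..m}. s' Cover c = s Cover c + (if c < k \<and> zero i c then \<delta> else 0))"], goal_cases)
  case (4 k s')
  then have "holds is_zero s' \<longleftrightarrow> zero i k"
    using ok i by (intro holds_is_zero) (auto simp: same_def)
  with 4 show ?case
    by (intro run_Cond[where T = 8] run_Store run_Skip)
      (auto simp: same_def less_Suc_eq test_cost_is_zero)
qed (use ok time in \<open>auto simp: same_def input_ok_def\<close>)

lemma run_give:
  assumes m: "s 0 1 = int m" and ex: "\<exists>c\<in>{1..m}. s Cover c < 1 \<and> s Owner c < 1"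
    and time: "m * 30 + 16 \<le> T"
  shows "run give s T (\<lambda>s'. same {Owner, Pick, Item} s s' \<and>
    (\<exists>c\<in>{1..m}. s Cover c < 1 \<and> s Owner c < 1 \<and> s' Owner = (s Owner)(c := s Agent 0)))"
  unfolding give_def
proof (rule run_Seq)
  \<comment> \<open>Before the first match \<open>Pick\<close> holds a leftover value, so it is
    constrained only once a match has been passed.\<close>
  define I where "I k s' \<longleftrightarrow> same {Pick, Item} s s' \<and>
      ((\<exists>c\<in>{1..<k}. s Cover c < 1 \<and> s Owner c < 1) \<longrightarrow>
       (\<exists>c\<in>{1..m}. s Cover c < 1 \<and> s Owner c < 1 \<and> s' Pick 0 = int c))"
    for k :: nat and s'
  show "run (For Item 1 (Cond
        (Conj (Less (Cell Cover (Var Item)) (Const 1)) (Less (Cell Owner (Var Item)) (Const 1)))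
        (Assign Pick (Var Item)) Skip)) s (m * 30 + 11) (I (Suc m))"
  proof (rule run_For[where I = I and N = m and T = 16], goal_cases)
    case (4 k s')
    then show ?case
      by (intro run_Cond[where T = 4] run_Store run_Skip)
        (auto simp: I_def same_def less_Suc_eq Bex_def)
  qed (use m in \<open>auto simp: I_def same_def\<close>)
next
  fix s' assume "same {Pick, Item} s s' \<and>
      ((\<exists>c\<in>{1..<Suc m}. s Cover c < 1 \<and> s Owner c < 1) \<longrightarrow>
       (\<exists>c\<in>{1..m}. s Cover c < 1 \<and> s Owner c < 1 \<and> s' Pick 0 = int c))"
  then show "run (Store Owner (Var Pick) (Var Agent)) s' 5 (\<lambda>s'. same {Owner, Pick, Item} s s' \<and>
    (\<exists>c\<in>{1..m}. s Cover c < 1 \<and> s Owner c < 1 \<and> s' Owner = (s Owner)(c := s Agent 0)))"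
    using ex by (intro run_Store) (auto simp: same_def atLeastLessThanSuc_atLeastAtMost)
qed (use time in auto)

definition cover :: "nat set \<Rightarrow> (nat \<Rightarrow> int) \<Rightarrow> bool" where
  "cover L f \<longleftrightarrow> (\<forall>c\<in>{1..m}. f c = int (card {i \<in> L. zero i c}))"

lemma cover_less_1:
  assumes "cover L f" "finite L" "c \<in> {1..m}"
  shows "f c < 1 \<longleftrightarrow> (\<forall>i\<in>L. \<not> zero i c)"
proof -
  have "finite {i \<in> L. zero i c}" using assms(2) by simp
  then have "card {i \<in> L. zero i c} = 0 \<longleftrightarrow> (\<forall>i\<in>L. \<not> zero i c)" by (auto simp: card_eq_0_iff)
  then show ?thesis using assms by (auto simp: cover_def)
qed

text \<open>The agent \<open>i\<close> itself contributes 1 to the count, so a value below 2 leaves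
  room for nobody else.\<close>

lemma cover_less_2:
  assumes "cover L f" "finite L" "c \<in> {1..m}" "i \<in> L"
  shows "zero i c \<and> f c < 2 \<longleftrightarrow> c \<in> sole L i"
proof (cases "zero i c")
  case True
  have "{j \<in> L. zero j c} = insert i {j \<in> L - {i}. zero j c}" using True assms(4) by auto
  then have "card {j \<in> L. zero j c} = Suc (card {j \<in> L - {i}. zero j c})"
    using assms(2) by simp
  moreover have "card {j \<in> L - {i}. zero j c} = 0 \<longleftrightarrow> (\<forall>j\<in>L - {i}. \<not> zero j c)"
    using assms(2) by (auto simp: card_eq_0_iff)
  ultimately show ?thesis using assms True by (auto simp: cover_def sole_def)
qed (auto simp: sole_def)

lemma cover_remove:
  assumes "cover L f" "finite L" "i \<in> L"
    and "\<forall>c\<in>{1..m}. f' c = f c + (if zero i c then -1 else 0)"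
  shows "cover (L - {i}) f'"
  unfolding cover_def
proof
  fix c assume c: "c \<in> {1..m}"
  have eq: "{j \<in> L. zero j c} = {j \<in> L - {i}. zero j c} \<union> (if zero i c then {i} else {})"
    using assms(3) by auto
  have "card {j \<in> L. zero j c} = card {j \<in> L - {i}. zero j c} + (if zero i c then 1 else 0)"
    unfolding eq using assms(2) by simp
  then show "f' c = int (card {j \<in> L - {i}. zero j c})"
    using assms c by (auto simp: cover_def)
qed

text \<open>The tests \<open>< 1\<close> on \<open>Cover\<close> and \<open>Owner\<close> recognize
  exactly the pending items, since owners are never negative under \<open>partial\<close>. The last
  conjunct records the concrete update, so that bundles before and after can be compared.\<close>

lemma run_give_partial:
  assumes ok: "input_ok (s 0) (s Row)" and cov: "cover L (s Cover)" "finite L"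
    and p: "partial q L F (s Owner)" and ne: "pend (s Owner) L \<noteq> {}"
    and i: "s Agent 0 = int i" "i \<in> {1..n}" "i \<notin> F" "i \<in> L"
    and time: "m * 30 + 16 \<le> T"
  shows "run give s T (\<lambda>s'. same {Owner, Pick, Item} s s' \<and>
    partial q L (insert i F) (s' Owner) \<and>
    Suc (card (pend (s' Owner) L)) = card (pend (s Owner) L) \<and>
    (\<exists>c. s Owner c = 0 \<and> s' Owner = (s Owner)(c := int i)))"
proof (rule run_conseq)
  have pend_iff: "c \<in> pend (s Owner) L \<longleftrightarrow> c \<in> {1..m} \<and> s Cover c < 1 \<and> s Owner c < 1" for c
  proof (cases "c \<in> {1..m}")
    case True
    then have "s Owner c \<in> int ` {0..n}" using p by (simp add: partial_def)
    then have "s Owner c < 1 \<longleftrightarrow> s Owner c = 0" by auto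
    then show ?thesis using True cover_less_1[OF cov True] by (auto simp: pend_def)
  qed (auto simp: pend_def)
  have "\<exists>c\<in>{1..m}. s Cover c < 1 \<and> s Owner c < 1" using ne pend_iff by blast
  from run_give[OF input_okD(2)[OF ok] this order_refl]
  show "run give s (m * 30 + 16) (\<lambda>s'. same {Owner, Pick, Item} s s' \<and>
    (\<exists>c\<in>{1..m}. s Cover c < 1 \<and> s Owner c < 1 \<and> s' Owner = (s Owner)(c := s Agent 0)))" .
  fix s' assume "same {Owner, Pick, Item} s s' \<and>
    (\<exists>c\<in>{1..m}. s Cover c < 1 \<and> s Owner c < 1 \<and> s' Owner = (s Owner)(c := s Agent 0))"
  then obtain c where c: "same {Owner, Pick, Item} s s'" "c \<in> pend (s Owner) L"
    "s' Owner = (s Owner)(c := int i)"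
    unfolding i(1) using pend_iff by blast
  have nz: "\<not> zero i c" using c i by (auto simp: pend_def)
  have "pend (s' Owner) L = pend (s Owner) L - {c}"
    unfolding c(3) by (rule pend_give) (use i in auto)
  then have "Suc (card (pend (s' Owner) L)) = card (pend (s Owner) L)"
    using card_Suc_Diff1[OF finite_pend c(2)] by simp
  then show "same {Owner, Pick, Item} s s' \<and> partial q L (insert i F) (s' Owner) \<and>
    Suc (card (pend (s' Owner) L)) = card (pend (s Owner) L) \<and>
    (\<exists>c. s Owner c = 0 \<and> s' Owner = (s Owner)(c := int i))"
    using c partial_give[OF p c(2) nz i(2,3)] by (auto simp: pend_def)
qed (use time in auto)

section \<open>Full rounds of universally costly chores\<close>

lemma run_rounds:
  assumes ok: "input_ok (s 0) (s Row)" and cov: "cover {1..n} (s Cover)"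
    and p: "partial 0 {1..n} {} (s Owner)" and e: "s Pending 0 = int (card (pend (s Owner) {1..n}))"
    and time: "m * (n * (m * 30 + 30) + 38) + 11 \<le> T"
  shows "run rounds s T (\<lambda>s'. same {Owner, Pick, Item, Agent, Pending, Round} s s' \<and>
    (\<exists>q. partial q {1..n} {} (s' Owner)) \<and>
    s' Pending 0 = int (card (pend (s' Owner) {1..n})) \<and> s' Pending 0 < int n)"
  unfolding rounds_def
\<comment> \<open>At most \<open>m\<close> items are pending at first and every active round uses up
  \<open>n\<close>, which is at least 1. At \<open>k = m + 1\<close> the second alternative forces
  \<open>Pending\<close> down to 0, so \<open>m\<close> iterations suffice.\<close>
proof (rule run_For[where N = m and T = "n * (m * 30 + 30) + 24" and
      I = "\<lambda>k s'. same {Owner, Pick, Item, Agent, Pending, Round} s s' \<and>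
        (\<exists>q. partial q {1..n} {} (s' Owner)) \<and>
        s' Pending 0 = int (card (pend (s' Owner) {1..n})) \<and>
        (s' Pending 0 < int n \<or> s' Pending 0 + int k \<le> int m + 1)"], goal_cases)
  case 1
  have "card (pend (s Owner) {1..n}) \<le> card {1..m}" by (rule card_mono) (auto simp: pend_def)
  then show ?case using p e by (auto simp: same_def)
next
  case (4 k s1)
  then obtain q where q: "partial q {1..n} {} (s1 Owner)" by blast
  have fr: "\<forall>a. a \<notin> {Owner, Pick, Item, Agent, Pending, Round} \<longrightarrow> s1 a = s a"
    using 4 by (simp add: same_def)
  define P where "P = card (pend (s1 Owner) {1..n})"
  show ?case
  proof (rule run_Cond[where T = "n * (m * 30 + 30) + 18"])
    assume "holds (Less (Var Pending) num_agents) s1"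
    then show "run Skip s1 (n * (m * 30 + 30) + 18) (\<lambda>s'. s' Round 0 = int k \<and>
        same {Owner, Pick, Item, Agent, Pending, Round} s s' \<and>
        (\<exists>q. partial q {1..n} {} (s' Owner)) \<and>
        s' Pending 0 = int (card (pend (s' Owner) {1..n})) \<and>
        (s' Pending 0 < int n \<or> s' Pending 0 + int (Suc k) \<le> int m + 1))"
      using 4 fr ok by (intro run_Skip) (auto simp: input_ok_def)
  next
    assume "\<not> holds (Less (Var Pending) num_agents) s1"
    then have nP: "n \<le> P" using 4 fr ok by (auto simp: input_ok_def P_def)
    show "run (Seq (For Agent 0 give) (Assign Pending (Sub (Var Pending) num_agents))) s1
        (n * (m * 30 + 30) + 18) (\<lambda>s'. s' Round 0 = int k \<and>
        same {Owner, Pick, Item, Agent, Pending, Round} s s' \<and>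
        (\<exists>q. partial q {1..n} {} (s' Owner)) \<and>
        s' Pending 0 = int (card (pend (s' Owner) {1..n})) \<and>
        (s' Pending 0 < int n \<or> s' Pending 0 + int (Suc k) \<le> int m + 1))"
    proof (rule run_Seq)
      show "run (For Agent 0 give) s1 (n * (m * 30 + 30) + 11)
        (\<lambda>s'. same {Owner, Pick, Item, Agent} s1 s' \<and> partial q {1..n} {1..n} (s' Owner) \<and>
          card (pend (s' Owner) {1..n}) + n = P)"
      proof (rule run_For[where N = n and T = "m * 30 + 16" and
            I = "\<lambda>j s'. same {Owner, Pick, Item, Agent} s1 s' \<and>
              partial q {1..n} {1..<j} (s' Owner) \<and> card (pend (s' Owner) {1..n}) + j = Suc P"],
          goal_cases)
        case (4 j s2)
        have fr2: "\<forall>a. a \<notin> {Owner, Pick, Item, Agent} \<longrightarrow> s2 a = s1 a"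
          using 4 by (simp add: same_def)
        have "card (pend (s2 Owner) {1..n}) + j = Suc P" using 4 by blast
        \<comment> \<open>The round started with at least \<open>n\<close> pending items and has
          used \<open>j - 1 < n\<close> of them.\<close>
        then have "card (pend (s2 Owner) {1..n}) \<noteq> 0" using 4(2) nP by linarith
        then have "pend (s2 Owner) {1..n} \<noteq> {}" by (metis card.empty)
        then have "run give s2 (m * 30 + 16) (\<lambda>s'. same {Owner, Pick, Item} s2 s' \<and>
            partial q {1..n} (insert j {1..<j}) (s' Owner) \<and>
            Suc (card (pend (s' Owner) {1..n})) = card (pend (s2 Owner) {1..n}) \<and>
            (\<exists>c. s2 Owner c = 0 \<and> s' Owner = (s2 Owner)(c := int j)))"
          by (intro run_give_partial) (use 4 fr fr2 ok cov in auto)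
        moreover have "insert j {1..<j} = {1..<Suc j}" using 4 by auto
        ultimately show ?case
          by (elim run_conseq) (use 4 in \<open>auto simp: same_def\<close>)
      qed (use q fr ok in \<open>auto simp: same_def P_def input_ok_def atLeastLessThanSuc_atLeastAtMost\<close>)
    next
      fix s2 assume s2: "same {Owner, Pick, Item, Agent} s1 s2 \<and>
          partial q {1..n} {1..n} (s2 Owner) \<and> card (pend (s2 Owner) {1..n}) + n = P"
      have fr2: "\<forall>a. a \<notin> {Owner, Pick, Item, Agent} \<longrightarrow> s2 a = s1 a"
        using s2 by (simp add: same_def)
      have "partial (Suc q) {1..n} {} (s2 Owner)" using s2 partial_round by blast
      then show "run (Assign Pending (Sub (Var Pending) num_agents)) s2 7 (\<lambda>s'. s' Round 0 = int k \<and>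
        same {Owner, Pick, Item, Agent, Pending, Round} s s' \<and>
        (\<exists>q. partial q {1..n} {} (s' Owner)) \<and>
        s' Pending 0 = int (card (pend (s' Owner) {1..n})) \<and>
        (s' Pending 0 < int n \<or> s' Pending 0 + int (Suc k) \<le> int m + 1))"
        using 4 s2 fr fr2 ok n_pos
        by (intro run_Store) (auto simp: same_def input_ok_def P_def)
    qed simp
  qed simp
qed (use ok n_pos time in \<open>auto simp: same_def input_ok_def add.commute\<close>)

section \<open>Dropping agents from \<open>L\<close>\<close>

definition flags :: "nat set \<Rightarrow> (nat \<Rightarrow> int) \<Rightarrow> bool" where
  "flags L f \<longleftrightarrow> (\<forall>i\<in>{1..n}. f i < 1 \<longleftrightarrow> i \<in> L)"

lemma flags_mark: "flags L f \<Longrightarrow> flags (L - {i}) (f(i := 1))"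
  by (auto simp: flags_def)

lemma card_pend_remove:
  assumes "partial q L F a" "i \<in> L"
  shows "card (pend a (L - {i})) = card (pend a L) + card (sole L i)"
  using pend_remove[OF assms] by (simp add: card_Un_disjoint)

lemma sole_antimono: "L' \<subseteq> L \<Longrightarrow> sole L i \<subseteq> sole L' i"
  by (auto simp: sole_def)

text \<open>Invariant of the drop pass. Dropped agents are one item ahead and count as served; since
  \<open>Gap\<close> is positive, the pending items never suffice for all of
  \<open>L\<close>.\<close>

definition dropping :: "nat \<Rightarrow> nat set \<Rightarrow> memory \<Rightarrow> bool" where
  "dropping q L s \<longleftrightarrow> L \<subseteq> {1..n} \<and> input_ok (s 0) (s Row) \<and> s Star 0 = 0 \<and>
     flags L (s Dropped) \<and> flags L (s Served) \<and> cover L (s Cover) \<and>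
     partial q L ({1..n} - L) (s Owner) \<and> s Pending 0 = int (card (pend (s Owner) L)) \<and>
     s Gap 0 + s Pending 0 = int (card L) \<and> 1 \<le> s Gap 0"

lemma dropping_update: "dropping q L (s(Agent := y)) = dropping q L s"
  by (simp add: dropping_def)

text \<open>\<open>L\<close> loses one agent, while the pending items lose the one given away and
  gain the \<open>Num\<close> released ones. Hence the gap falls by exactly \<open>Num\<close>, and
  it stays positive because \<open>Num\<close> was smaller.\<close>

lemma run_drop_agent:
  assumes d: "dropping q L s" and k: "s Agent 0 = int k" "k \<in> L"
    and num: "s Num 0 = int (card (sole L k))" "s Num 0 < s Gap 0" and e: "0 < s Pending 0"
    and time: "m * 62 + 51 \<le> T"
  shows "run drop_agent s T (\<lambda>s'. dropping q (L - {k}) s' \<and> s' Agent 0 = int k \<and>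
    s' Gap 0 \<le> s Gap 0)"
  unfolding drop_agent_def
proof (rule run_Seq)
  have L: "L \<subseteq> {1..n}" "finite L" "k \<in> {1..n}"
    using d k finite_subset[of L "{1..n}"] by (auto simp: dropping_def)
  have ne: "pend (s Owner) L \<noteq> {}" using d e by (auto simp: dropping_def)
  show "run give s (m * 30 + 16) (\<lambda>s'. same {Owner, Pick, Item} s s' \<and>
    partial q L (insert k ({1..n} - L)) (s' Owner) \<and>
    Suc (card (pend (s' Owner) L)) = card (pend (s Owner) L) \<and>
    (\<exists>c. s Owner c = 0 \<and> s' Owner = (s Owner)(c := int k)))"
    by (rule run_give_partial) (use d L k ne in \<open>auto simp: dropping_def\<close>)
  fix s1 assume s1: "same {Owner, Pick, Item} s s1 \<and>
    partial q L (insert k ({1..n} - L)) (s1 Owner) \<and>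
    Suc (card (pend (s1 Owner) L)) = card (pend (s Owner) L) \<and>
    (\<exists>c. s Owner c = 0 \<and> s1 Owner = (s Owner)(c := int k))"
  have fr1: "\<forall>a. a \<notin> {Owner, Pick, Item} \<longrightarrow> s1 a = s a"
    using s1 by (simp add: same_def)
  have set_eq: "insert k ({1..n} - L) = {1..n} - (L - {k})" using L k by auto
  have p1: "partial q (L - {k}) ({1..n} - (L - {k})) (s1 Owner)"
    using s1 partial_antimono[of q L _ "s1 Owner" "L - {k}"] set_eq by auto
  have pend1: "card (pend (s1 Owner) (L - {k})) = card (pend (s1 Owner) L) + card (sole L k)"
    using s1 card_pend_remove k(2) by blast
  show "run (Seq (adjust (-1))
     (Seq (Store Dropped (Var Agent) (Const 1))
     (Seq (Store Served (Var Agent) (Const 1))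
     (Seq (Assign Pending (Sub (Add (Var Pending) (Var Num)) (Const 1)))
          (Assign Gap (Sub (Var Gap) (Var Num))))))) s1 (m * 32 + 35)
    (\<lambda>s'. dropping q (L - {k}) s' \<and> s' Agent 0 = int k \<and> s' Gap 0 \<le> s Gap 0)"
  proof (rule run_Seq)
    show "run (adjust (-1)) s1 (m * 32 + 11) (\<lambda>s'. same {Cover, Item} s1 s' \<and>
      (\<forall>c\<in>{1..m}. s' Cover c = s1 Cover c + (if zero k c then -1 else 0)))"
      by (rule run_adjust) (use d fr1 L k in \<open>auto simp: dropping_def\<close>)
    fix s2 assume s2: "same {Cover, Item} s1 s2 \<and>
      (\<forall>c\<in>{1..m}. s2 Cover c = s1 Cover c + (if zero k c then -1 else 0))"
    have fr2: "\<forall>a. a \<notin> {Cover, Item} \<longrightarrow> s2 a = s1 a"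
      using s2 by (simp add: same_def)
    have "cover L (s1 Cover)" using d fr1 by (simp add: dropping_def)
    then have cov2: "cover (L - {k}) (s2 Cover)"
      using s2 cover_remove L(2) k(2) by blast
    have cardL: "int (card (L - {k})) = int (card L) - 1"
      using card.remove[OF L(2) k(2)] by linarith
    show "run (Seq (Store Dropped (Var Agent) (Const 1))
     (Seq (Store Served (Var Agent) (Const 1))
     (Seq (Assign Pending (Sub (Add (Var Pending) (Var Num)) (Const 1)))
          (Assign Gap (Sub (Var Gap) (Var Num)))))) s2 24
      (\<lambda>s'. dropping q (L - {k}) s' \<and> s' Agent 0 = int k \<and> s' Gap 0 \<le> s Gap 0)"
      by (intro run_Store_Seq run_Store)
        (use d fr1 fr2 cov2 p1 pend1 s1 k num cardL in \<open>auto simp: dropping_def flags_mark\<close>)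
  qed simp
qed (use time in simp)

text \<open>A single pass suffices: as \<open>L\<close> shrinks the gap can only fall and the sets
  \<open>sole L i\<close> can only grow, so an agent that was kept once still satisfies the bound
  later. Agents not yet visited are still in \<open>L\<close>.\<close>

lemma run_drop_pass:
  assumes d: "dropping q {1..n} s" and time: "n * (m * 98 + 90) + 11 \<le> T"
  shows "run drop_pass s T (\<lambda>s'. \<exists>L. dropping q L s' \<and>
    (0 < s' Pending 0 \<longrightarrow> (\<forall>i\<in>L. s' Gap 0 \<le> int (card (sole L i)))))"
  unfolding drop_pass_def
proof (rule run_For[where N = n and T = "m * 98 + 76" and
      I = "\<lambda>k s'. \<exists>L. {k..n} \<subseteq> L \<and> dropping q L s' \<and>
        (0 < s' Pending 0 \<longrightarrow> (\<forall>i\<in>L. i < k \<longrightarrow> s' Gap 0 \<le> int (card (sole L i))))"], goal_cases)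
  case (4 k s1)
  let ?Q = "\<lambda>s'. s' Agent 0 = int k \<and> (\<exists>L. {Suc k..n} \<subseteq> L \<and> dropping q L s' \<and>
        (0 < s' Pending 0 \<longrightarrow> (\<forall>i\<in>L. i < Suc k \<longrightarrow> s' Gap 0 \<le> int (card (sole L i)))))"
  obtain L where L: "{k..n} \<subseteq> L" "dropping q L s1"
    "0 < s1 Pending 0 \<longrightarrow> (\<forall>i\<in>L. i < k \<longrightarrow> s1 Gap 0 \<le> int (card (sole L i)))"
    using 4 by blast
  have kL: "k \<in> L" "k \<in> {1..n}" and fin: "finite L"
    using L 4 finite_subset[of L "{1..n}"] by (auto simp: dropping_def)
  have skip: "?Q s1" if "0 < s1 Pending 0 \<longrightarrow> s1 Gap 0 \<le> int (card (sole L k))"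
    using L that 4(4) by (intro conjI exI[of _ L]) (auto simp: less_Suc_eq)
  show ?case
  proof (rule run_Cond[where T = "m * 98 + 71"])
    assume "\<not> holds (Less (Const 0) (Var Pending)) s1"
    then show "run Skip s1 (m * 98 + 71) ?Q" using skip by (intro run_Skip) auto
  next
    assume "holds (Less (Const 0) (Var Pending)) s1"
    then have e: "0 < s1 Pending 0" by simp
    let ?b = "Conj is_zero (Less (Cell Cover (Var Item)) (Const 2))"
    show "run (Seq (count ?b) (Cond (Less (Var Num) (Var Gap)) drop_agent Skip)) s1
      (m * 98 + 71) ?Q"
    proof (rule run_Seq)
      show "run (count ?b) s1 (m * 36 + 14)
        (\<lambda>s'. same {Num, Item} s1 s' \<and> s' Num 0 = int (card {c \<in> {1..m}. c \<in> sole L k}))"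
      proof (rule run_count)
        fix s' c assume c: "c \<in> {1..m}" "same {Num, Item} s1 s'" "s' Item 0 = int c"
        have fr: "\<forall>a. a \<notin> {Num, Item} \<longrightarrow> s' a = s1 a" using c by (simp add: same_def)
        have "holds is_zero s' \<longleftrightarrow> zero k c"
          by (rule holds_is_zero) (use fr L 4 kL c in \<open>auto simp: dropping_def\<close>)
        then show "holds ?b s' \<longleftrightarrow> c \<in> sole L k"
          using cover_less_2[of L "s1 Cover" c k] fr L(2) kL fin c by (auto simp: dropping_def)
      qed (use L in \<open>auto simp: dropping_def input_ok_def test_cost_is_zero\<close>)
    next
      fix s2 assume s2: "same {Num, Item} s1 s2 \<and>
        s2 Num 0 = int (card {c \<in> {1..m}. c \<in> sole L k})"
      have fr: "\<forall>a. a \<notin> {Num, Item} \<longrightarrow> s2 a = s1 a" using s2 by (simp add: same_def)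
      have "{c \<in> {1..m}. c \<in> sole L k} = sole L k" by (auto simp: sole_def)
      then have num: "s2 Num 0 = int (card (sole L k))" using s2 by simp
      have d2: "dropping q L s2" using L(2) fr by (simp add: dropping_def)
      show "run (Cond (Less (Var Num) (Var Gap)) drop_agent Skip) s2 (m * 62 + 57) ?Q"
      proof (rule run_Cond[where T = "m * 62 + 51"])
        assume "\<not> holds (Less (Var Num) (Var Gap)) s2"
        then have "s2 Gap 0 \<le> int (card (sole L k))" using num by simp
        then show "run Skip s2 (m * 62 + 51) ?Q"
          using L d2 fr 4(4) by (intro run_Skip conjI exI[of _ L]) (auto simp: less_Suc_eq)
      next
        assume "holds (Less (Var Num) (Var Gap)) s2"
        then have "run drop_agent s2 (m * 62 + 51) (\<lambda>s'. dropping q (L - {k}) s' \<and>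
            s' Agent 0 = int k \<and> s' Gap 0 \<le> s2 Gap 0)"
          by (intro run_drop_agent) (use d2 fr 4(4) kL num e in auto)
        then show "run drop_agent s2 (m * 62 + 51) ?Q"
        proof (rule run_conseq)
          fix s' assume s': "dropping q (L - {k}) s' \<and> s' Agent 0 = int k \<and> s' Gap 0 \<le> s2 Gap 0"
          have "s' Gap 0 \<le> int (card (sole (L - {k}) i))" if "i \<in> L - {k}" "i < Suc k" for i
          proof -
            have "s' Gap 0 \<le> s1 Gap 0" using s' fr by simp
            also have "\<dots> \<le> int (card (sole L i))" using L(3) e that by auto
            also have "\<dots> \<le> int (card (sole (L - {k}) i))"
              by (simp add: card_mono sole_antimono)
            finally show ?thesis .
          qed
          then show "?Q s'" using s' L(1) by (intro conjI exI[of _ "L - {k}"]) auto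
        qed simp
      qed simp
    qed simp
  qed simp
next
  case 1
  then show ?case using d by (intro exI[of _ "{1..n}"]) (auto simp: dropping_def)
next
  case (5 s1)
  then obtain L where L: "dropping q L s1"
    "0 < s1 Pending 0 \<longrightarrow> (\<forall>i\<in>L. i < Suc n \<longrightarrow> s1 Gap 0 \<le> int (card (sole L i)))"
    by blast
  then have "L \<subseteq> {1..n}" by (simp add: dropping_def)
  then show ?case using L by (intro exI[of _ L]) auto
next
  case 6
  then show ?case using time by (simp add: add.commute)
qed (auto simp: dropping_update dropping_def input_ok_def)

section \<open>Serving agents of \<open>L\<close> with the pending items\<close>

text \<open>\<open>G\<close> collects the served agents. \<open>L\<close> is now fixed, so
  \<open>Pending\<close> and the number of unserved agents fall together and their difference
  \<open>g\<close> is constant.\<close>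

definition serving :: "nat \<Rightarrow> nat set \<Rightarrow> int \<Rightarrow> nat set \<Rightarrow> memory \<Rightarrow> bool" where
  "serving q L g G s \<longleftrightarrow> L \<subseteq> {1..n} \<and> G \<subseteq> L \<and> input_ok (s 0) (s Row) \<and>
     flags L (s Dropped) \<and> flags (L - G) (s Served) \<and> cover L (s Cover) \<and>
     partial q L ({1..n} - (L - G)) (s Owner) \<and> s Pending 0 = int (card (pend (s Owner) L)) \<and>
     g + s Pending 0 = int (card (L - G)) \<and> 1 \<le> g \<and>
     (if G = {} then s Star 0 = 0 else s Star 0 \<in> int ` G)"

lemma serving_update: "serving q L g G (s(Agent := y)) = serving q L g G s"
  by (simp add: serving_def)

text \<open>Anybody served proves that items were pending, so the bound in \<open>large\<close> is
  carried along for the case of nonempty \<open>G\<close>.\<close>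

lemma run_serve_pass:
  assumes d: "serving q L g {} s"
    and large: "0 < s Pending 0 \<longrightarrow> (\<forall>i\<in>L. g \<le> int (card (sole L i)))"
    and time: "n * (m * 30 + 55) + 11 \<le> T"
  shows "run serve_pass s T (\<lambda>s'. \<exists>G. serving q L g G s' \<and> s' Pending 0 = 0 \<and>
    (G \<noteq> {} \<longrightarrow> (\<forall>i\<in>L. g \<le> int (card (sole L i)))))"
  unfolding serve_pass_def
proof (rule run_For[where N = n and T = "m * 30 + 41" and
      I = "\<lambda>k s'. \<exists>G. serving q L g G s' \<and> G \<subseteq> {1..<k} \<and>
        (0 < s' Pending 0 \<longrightarrow> L \<inter> {1..<k} \<subseteq> G) \<and>
        (0 < s' Pending 0 \<or> G \<noteq> {} \<longrightarrow> (\<forall>i\<in>L. g \<le> int (card (sole L i))))"], goal_cases)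
  case 1
  then show ?case using d large by (intro exI[of _ "{}"]) auto
next
  case (4 k s1)
  let ?Q = "\<lambda>s'. s' Agent 0 = int k \<and> (\<exists>G. serving q L g G s' \<and> G \<subseteq> {1..<Suc k} \<and>
        (0 < s' Pending 0 \<longrightarrow> L \<inter> {1..<Suc k} \<subseteq> G) \<and>
        (0 < s' Pending 0 \<or> G \<noteq> {} \<longrightarrow> (\<forall>i\<in>L. g \<le> int (card (sole L i)))))"
  let ?b = "Conj (Less (Const 0) (Var Pending)) (Less (Cell Dropped (Var Agent)) (Const 1))"
  obtain G where G: "serving q L g G s1" "0 < s1 Pending 0 \<longrightarrow> L \<inter> {1..<k} \<subseteq> G"
    "0 < s1 Pending 0 \<or> G \<noteq> {} \<longrightarrow> (\<forall>i\<in>L. g \<le> int (card (sole L i)))"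
    and Gk: "G \<subseteq> {1..<k}"
    using 4 by blast
  have k: "k \<in> {1..n}" "k \<notin> G" using 4 Gk by auto
  have fin: "finite L" using G(1) finite_subset[of L "{1..n}"] by (auto simp: serving_def)
  have hb: "holds ?b s1 \<longleftrightarrow> 0 < s1 Pending 0 \<and> k \<in> L"
    using G(1) k 4(4) by (auto simp: serving_def flags_def)
  show ?case
  proof (rule run_Cond[where T = "m * 30 + 30"])
    assume "\<not> holds ?b s1"
    then have "0 < s1 Pending 0 \<longrightarrow> L \<inter> {1..<Suc k} \<subseteq> G"
      using hb G(2) by (auto simp: less_Suc_eq)
    then show "run Skip s1 (m * 30 + 30) ?Q"
      using G Gk 4(4) by (intro run_Skip conjI exI[of _ G]) auto
  next
    assume "holds ?b s1"
    then have e: "0 < s1 Pending 0" and kL: "k \<in> L" using hb by auto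
    show "run (Seq give (Seq (Store Served (Var Agent) (Const 1))
         (Seq (Assign Pending (Sub (Var Pending) (Const 1))) (Assign Star (Var Agent)))))
       s1 (m * 30 + 30) ?Q"
      proof (rule run_Seq)
        have ne: "pend (s1 Owner) L \<noteq> {}" using G e by (auto simp: serving_def)
        show "run give s1 (m * 30 + 16) (\<lambda>s'. same {Owner, Pick, Item} s1 s' \<and>
          partial q L (insert k ({1..n} - (L - G))) (s' Owner) \<and>
          Suc (card (pend (s' Owner) L)) = card (pend (s1 Owner) L) \<and>
          (\<exists>c. s1 Owner c = 0 \<and> s' Owner = (s1 Owner)(c := int k)))"
          by (rule run_give_partial) (use G(1) fin k kL ne 4(4) in \<open>auto simp: serving_def\<close>)
        fix s2 assume s2: "same {Owner, Pick, Item} s1 s2 \<and>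
          partial q L (insert k ({1..n} - (L - G))) (s2 Owner) \<and>
          Suc (card (pend (s2 Owner) L)) = card (pend (s1 Owner) L) \<and>
          (\<exists>c. s1 Owner c = 0 \<and> s2 Owner = (s1 Owner)(c := int k))"
        have fr: "\<forall>a. a \<notin> {Owner, Pick, Item} \<longrightarrow> s2 a = s1 a" using s2 by (simp add: same_def)
        have sets: "insert k ({1..n} - (L - G)) = {1..n} - (L - insert k G)"
          "L - insert k G = (L - G) - {k}" using k kL by auto
        have "int (card (L - insert k G)) = int (card (L - G)) - 1"
        proof -
          have "finite (L - G)" "k \<in> L - G" using fin kL k by auto
          from card.remove[OF this] show ?thesis unfolding sets(2) by linarith
        qed
        moreover have "flags (L - insert k G) ((s1 Served)(k := 1))"
          unfolding sets(2) by (rule flags_mark) (use G(1) in \<open>simp add: serving_def\<close>)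
        moreover have "L \<inter> {1..<Suc k} \<subseteq> insert k G" using G(2) e by (auto simp: less_Suc_eq)
        moreover have "partial q L ({1..n} - (L - insert k G)) (s2 Owner)"
          using s2 unfolding sets(1) by blast
        moreover have "int (card (pend (s2 Owner) L)) = int (card (pend (s1 Owner) L)) - 1"
          using s2 by linarith
        moreover have Gk': "G \<subseteq> {1..<Suc k}" using Gk by auto
        moreover note G(1)[unfolded serving_def]
        ultimately show "run (Seq (Store Served (Var Agent) (Const 1))
         (Seq (Assign Pending (Sub (Var Pending) (Const 1))) (Assign Star (Var Agent)))) s2 14 ?Q"
          by (intro run_Store_Seq run_Store conjI exI[of _ "insert k G"])
            (use G(3) Gk' fr kL 4(1,4) e in \<open>simp_all add: serving_def\<close>)
      qed simp
  qed simp
next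
  case (5 s1)
  then obtain G where G: "serving q L g G s1" "0 < s1 Pending 0 \<longrightarrow> L \<inter> {1..<Suc n} \<subseteq> G"
    "0 < s1 Pending 0 \<or> G \<noteq> {} \<longrightarrow> (\<forall>i\<in>L. g \<le> int (card (sole L i)))"
    by blast
  \<comment> \<open>If items were left, all of \<open>L\<close> would have been served,
    contradicting that at least \<open>g\<close> agents are unserved.\<close>
  have "s1 Pending 0 = 0"
  proof (rule ccontr)
    assume "s1 Pending 0 \<noteq> 0"
    then have pos: "0 < s1 Pending 0" using G(1) by (auto simp: serving_def)
    have sv: "L \<subseteq> {1..n}" "g + s1 Pending 0 = int (card (L - G))" "1 \<le> g"
      using G(1) unfolding serving_def by blast+
    have "L \<subseteq> {1..<Suc n}" using sv(1) by auto
    then have "L - G = {}" using G(2) pos by blast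
    then have "card (L - G) = 0" by (metis card.empty)
    then show False using sv(2,3) pos by linarith
  qed
  then show ?case using G(1,3) by (intro exI[of _ G]) simp
next
  case (2 k s1 y)
  then show ?case by (simp only: serving_update fun_upd_apply) simp
next
  case (3 k s1)
  then show ?case unfolding serving_def input_ok_def by blast
next
  case 6
  then show ?case using time by (simp add: add.commute)
qed

section \<open>The star agent\<close>

text \<open>With nothing pending, each unassigned item has an agent of \<open>L\<close> for whom it
  is free, and any such choice leads to a solution.\<close>

definition ready :: "nat set \<Rightarrow> memory \<Rightarrow> bool" where
  "ready L s \<longleftrightarrow> L \<subseteq> {1..n} \<and> input_ok (s 0) (s Row) \<and> flags L (s Dropped) \<and>
     pend (s Owner) L = {} \<and> (\<forall>c\<in>{1..m}. s Owner c \<in> int ` {0..n}) \<and>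
     (\<forall>a'. complete_by L (s Owner) a' \<longrightarrow> solution a')"

text \<open>If nobody was served, \<open>solution_low\<close> applies at once. Otherwise the star
  agent \<open>i0\<close> has at least \<open>g\<close> items free for it alone within
  \<open>L\<close>, enough for the \<open>g\<close> unserved agents, and
  \<open>solution_high\<close> applies.\<close>

lemma run_star_pass:
  assumes sv: "serving q L g G s" and e: "s Pending 0 = 0"
    and large: "G \<noteq> {} \<longrightarrow> (\<forall>i\<in>L. g \<le> int (card (sole L i)))"
    and time: "m * 32 + n * (m * 30 + 36) + 31 \<le> T"
  shows "run star_pass s T (ready L)"
proof (cases "G = {}")
  case True
  have p: "partial q L ({1..n} - L) (s Owner)" "L \<subseteq> {1..n}" using sv True by (auto simp: serving_def)
  have "ready L s"
    using sv True e p solution_low[OF p] by (auto simp: ready_def serving_def partial_def)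
  then show ?thesis
    unfolding star_pass_def using sv True time
    by (intro run_Cond[where T = 1] run_Skip) (auto simp: serving_def)
next
  case False
  then obtain i0 where i0: "i0 \<in> G" "s Star 0 = int i0" using sv by (auto simp: serving_def)
  have i0': "i0 \<in> L" "i0 \<in> {1..n}" using i0 sv by (auto simp: serving_def)
  have L: "L \<subseteq> {1..n}" "G \<subseteq> L" and p: "partial q L ({1..n} - (L - G)) (s Owner)"
    and g: "g = int (card (L - G))" "1 \<le> g" and cov: "cover L (s Cover)"
    and pend0: "pend (s Owner) L = {}"
    using sv e by (auto simp: serving_def)
  have fin: "finite L" using L finite_subset by blast
  have big: "card (L - G) \<le> card (sole L i)" if "i \<in> L" for i
    using large False that g by auto
  \<comment> \<open>The agents already one item ahead, both dropped and served. So far all assigned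
    items cost \<open>i0\<close>, so it sees the full \<open>Suc q\<close> in their bundles.\<close>
  define F0 where "F0 = {1..n} - (L - G)"
  have star0: "Suc q \<le> cost i0 (share (s Owner) j)" if j: "j \<in> F0" for j
  proof -
    have "j \<ge> 1" using j by (auto simp: F0_def)
    then have "cost i0 (share (s Owner) j) = card (share (s Owner) j)"
      by (intro cost_eq_card) (use partial_costly(2)[OF p] i0' in auto)
    also have "\<dots> = Suc q" using p j unfolding F0_def partial_def by auto
    finally show ?thesis by simp
  qed
  \<comment> \<open>The invariant is relative to \<open>L - {i0}\<close>, as the items now handed
    out are free for \<open>i0\<close>. The cardinality bound keeps enough of them for the unserved
    agents still to come.\<close>
  define I where "I k s' \<longleftrightarrow> same {Owner, Cover, Pick, Item, Agent} s s' \<and>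
      cover (L - {i0}) (s' Cover) \<and>
      partial q (L - {i0}) (F0 \<union> {1..<k}) (s' Owner) \<and> pend (s' Owner) L = {} \<and>
      card ((L - G) - {1..<k}) \<le> card (pend (s' Owner) (L - {i0})) \<and>
      (\<forall>j\<in>F0. Suc q \<le> cost i0 (share (s' Owner) j))" for k s'
  have sF0: "j \<in> L - G \<longleftrightarrow> j \<notin> F0" if "j \<in> {1..n}" for j using that by (auto simp: F0_def)
  show ?thesis
    unfolding star_pass_def
  proof (rule run_Cond[where T = "m * 32 + n * (m * 30 + 36) + 26"])
    assume "\<not> holds (Less (Const 0) (Var Star)) s"
    then show "run Skip s (m * 32 + n * (m * 30 + 36) + 26) (ready L)"
      using i0 i0' by auto
  next
    have "run (Seq (adjust (-1))
         (For Agent 0 (Cond (Less (Cell Served (Var Agent)) (Const 1)) give Skip)))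
         (s(Agent := (s Agent)(0 := int i0))) (m * 32 + n * (m * 30 + 36) + 22) (ready L)"
    proof (rule run_Seq)
      let ?s0 = "s(Agent := (s Agent)(0 := int i0))"
      show "run (adjust (-1)) ?s0 (m * 32 + 11) (\<lambda>s'. same {Cover, Item} ?s0 s' \<and>
        (\<forall>c\<in>{1..m}. s' Cover c = ?s0 Cover c + (if zero i0 c then -1 else 0)))"
        by (rule run_adjust) (use sv i0' in \<open>auto simp: serving_def\<close>)
      fix s1 assume s1: "same {Cover, Item} ?s0 s1 \<and>
        (\<forall>c\<in>{1..m}. s1 Cover c = ?s0 Cover c + (if zero i0 c then -1 else 0))"
      have fr1: "\<forall>a. a \<notin> {Cover, Item, Agent} \<longrightarrow> s1 a = s a"
        using s1 by (simp add: same_def)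
      have cov1: "cover (L - {i0}) (s1 Cover)"
        by (rule cover_remove[OF cov fin i0'(1)]) (use s1 in simp)
      \<comment> \<open>Nothing is pending for \<open>L\<close>, so what is pending for
        \<open>L - {i0}\<close> is exactly \<open>sole L i0\<close>.\<close>
      have "card (L - G) \<le> card (pend (s Owner) (L - {i0}))"
        using card_pend_remove[OF p i0'(1)] big[OF i0'(1)] by simp
      then have "I 1 s1"
        using fr1 cov1 pend0 star0 partial_antimono[OF p, of "L - {i0}"]
        by (auto simp: I_def same_def F0_def)
      then show "run (For Agent 0 (Cond (Less (Cell Served (Var Agent)) (Const 1)) give Skip)) s1
         (n * (m * 30 + 36) + 11) (ready L)"
      proof (rule run_For[where I = I and N = n and T = "m * 30 + 22"], goal_cases)
        case (1 k s2 y)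
        then show ?case by (simp add: I_def same_def)
      next
        case (2 k s2)
        then show ?case using sv by (simp add: I_def same_def serving_def input_ok_def)
      next
        case (3 k s2)
        have k: "k \<in> {1..n}" using 3 by simp
        have fr2: "\<forall>a. a \<notin> {Owner, Cover, Pick, Item, Agent} \<longrightarrow> s2 a = s a"
          using 3 by (simp add: I_def same_def)
        have hk: "holds (Less (Cell Served (Var Agent)) (Const 1)) s2 \<longleftrightarrow> k \<in> L - G"
          using sv fr2 3 k by (simp add: serving_def flags_def)
        have ivl: "{1..<Suc k} = insert k {1..<k}" using k by auto
        show ?case
        proof (rule run_Cond[where T = "m * 30 + 16"])
          assume "\<not> holds (Less (Cell Served (Var Agent)) (Const 1)) s2"
          then have kF: "k \<notin> L - G" "k \<in> F0" using hk sF0 k by auto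
          have "F0 \<union> {1..<Suc k} = F0 \<union> {1..<k}" "L - G - {1..<Suc k} = L - G - {1..<k}"
            unfolding ivl using kF by auto
          then have "I (Suc k) s2" using 3(3) unfolding I_def by metis
          then show "run Skip s2 (m * 30 + 16) (\<lambda>s'. s' Agent 0 = int k \<and> I (Suc k) s')"
            using 3 by (intro run_Skip) auto
        next
          assume "holds (Less (Cell Served (Var Agent)) (Const 1)) s2"
          then have kL: "k \<in> L - G" "k \<notin> F0" using hk sF0 k by auto
          have kin: "k \<in> L - G - {1..<k}" using kL by simp
          have cd: "card (L - G - {1..<k}) = Suc (card (L - G - {1..<Suc k}))"
          proof -
            have "L - G - {1..<Suc k} = L - G - {1..<k} - {k}" unfolding ivl by auto
            then show ?thesis using card.remove[OF _ kin] fin by (metis finite_Diff)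
          qed
          have I2: "cover (L - {i0}) (s2 Cover)" "partial q (L - {i0}) (F0 \<union> {1..<k}) (s2 Owner)"
            "pend (s2 Owner) L = {}"
            "card (L - G - {1..<k}) \<le> card (pend (s2 Owner) (L - {i0}))"
            "\<forall>j\<in>F0. Suc q \<le> cost i0 (share (s2 Owner) j)"
            using 3(3) unfolding I_def by blast+
          have ne: "pend (s2 Owner) (L - {i0}) \<noteq> {}" using I2(4) cd by auto
          have "run give s2 (m * 30 + 16) (\<lambda>s'. same {Owner, Pick, Item} s2 s' \<and>
              partial q (L - {i0}) (insert k (F0 \<union> {1..<k})) (s' Owner) \<and>
              Suc (card (pend (s' Owner) (L - {i0}))) = card (pend (s2 Owner) (L - {i0})) \<and>
              (\<exists>c. s2 Owner c = 0 \<and> s' Owner = (s2 Owner)(c := int k)))"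
            by (rule run_give_partial[OF _ I2(1) _ I2(2) ne])
              (use sv fr2 fin 3 k kL i0 in \<open>auto simp: serving_def\<close>)
          then show "run give s2 (m * 30 + 16) (\<lambda>s'. s' Agent 0 = int k \<and> I (Suc k) s')"
          proof (rule run_conseq)
            fix s3 assume s3: "same {Owner, Pick, Item} s2 s3 \<and>
              partial q (L - {i0}) (insert k (F0 \<union> {1..<k})) (s3 Owner) \<and>
              Suc (card (pend (s3 Owner) (L - {i0}))) = card (pend (s2 Owner) (L - {i0})) \<and>
              (\<exists>c. s2 Owner c = 0 \<and> s3 Owner = (s2 Owner)(c := int k))"
            have fr3: "\<forall>a. a \<notin> {Owner, Pick, Item} \<longrightarrow> s3 a = s2 a"
              using s3 by (simp add: same_def)
            obtain c where c: "s3 Owner = (s2 Owner)(c := int k)" "s2 Owner c = 0" using s3 by blast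
            have "pend (s3 Owner) L = {}" unfolding c(1) using pend_give[of k] I2(3) k by auto
            moreover have "share (s2 Owner) j \<subseteq> share (s3 Owner) j" if "j \<in> F0" for j
              unfolding c(1) using that c(2) by (auto simp: share_def F0_def)
            then have "\<forall>j\<in>F0. Suc q \<le> cost i0 (share (s3 Owner) j)"
              using I2(5) cost_mono finite_share by (meson order_trans)
            moreover have "F0 \<union> {1..<Suc k} = insert k (F0 \<union> {1..<k})" unfolding ivl by simp
            ultimately show "s3 Agent 0 = int k \<and> I (Suc k) s3"
              using s3 fr3 fr2 3(4) I2(1,4) cd by (simp add: I_def same_def)
          qed simp
        qed simp
      next
        case (4 s2)
        have fr2: "\<forall>a. a \<notin> {Owner, Cover, Pick, Item, Agent} \<longrightarrow> s2 a = s a"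
          using 4 by (simp add: I_def same_def)
        have "F0 \<union> {1..<Suc n} = {1..n}" by (auto simp: F0_def)
        then have p2: "partial q (L - {i0}) {1..n} (s2 Owner)" and pe: "pend (s2 Owner) L = {}"
          and st: "\<forall>j\<in>F0. Suc q \<le> cost i0 (share (s2 Owner) j)"
          using 4 unfolding I_def by auto
        have "solution a'" if "complete_by L (s2 Owner) a'" for a'
        proof (rule solution_high[OF p2 L(1) i0'(1) that])
          fix j assume j: "j \<in> {1..n}"
          show "Suc q \<le> cost i0 (share (s2 Owner) j) \<or>
            (j \<in> L - {i0} \<and> q \<le> cost i0 (share (s2 Owner) j) \<and> sole L j \<noteq> {})"
          proof (cases "j \<in> F0")
            case True
            then show ?thesis using st by blast
          next
            case False
            \<comment> \<open>An agent outside \<open>F0\<close> was not served, hence it differs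
              from \<open>i0\<close>, and it has private free items because \<open>g\<close> is at
              least 1.\<close>
            then have jL: "j \<in> L" "j \<noteq> i0" using sF0[OF j] i0 by auto
            have "sole L j \<noteq> {}" using big[OF jL(1)] g by auto
            moreover have "q \<le> cost i0 (share (s2 Owner) j)"
              using p2 i0' j unfolding partial_def by blast
            ultimately show ?thesis using jL by blast
          qed
        qed
        then show ?case
          using sv fr2 L pe p2 unfolding ready_def serving_def partial_def by simp
      qed simp
    qed simp
    then show "run (Seq (Assign Agent (Var Star)) (Seq (adjust (-1))
       (For Agent 0 (Cond (Less (Cell Served (Var Agent)) (Const 1)) give Skip)))) s
       (m * 32 + n * (m * 30 + 36) + 26) (ready L)"
      using i0 by (intro run_Store_Seq) (auto elim!: run_conseq)
  qed (use time in simp)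
qed

section \<open>Completing the allocation with free items\<close>

lemma run_final_pass:
  assumes r: "ready L s" and time: "m * (n * 35 + 31) + 11 \<le> T"
  shows "run final_pass s T (\<lambda>s'. solution (s' Owner))"
  unfolding final_pass_def
proof (rule run_For[where N = m and T = "n * 35 + 17" and
      I = "\<lambda>k s'. same {Owner, Item, Agent} s s' \<and>
        (\<forall>c\<in>{1..m}. if c < k \<and> s Owner c = 0
          then \<exists>j\<in>L. zero j c \<and> s' Owner c = int j else s' Owner c = s Owner c)"], goal_cases)
  case 1
  then show ?case by (simp add: same_def)
next
  case (2 k s1 y)
  then show ?case by (simp add: same_def)
next
  case (3 k s1)
  then show ?case using r by (simp add: same_def ready_def input_ok_def)
next
  case (4 k s1)
  define J where "J s' \<longleftrightarrow> s' Item 0 = int k \<and> same {Owner, Item, Agent} s s' \<and>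
    (\<forall>c\<in>{1..m}. if c < Suc k \<and> s Owner c = 0
      then \<exists>j\<in>L. zero j c \<and> s' Owner c = int j else s' Owner c = s Owner c)" for s'
  have k: "k \<in> {1..m}" using 4 by simp
  have fr1: "\<forall>a. a \<notin> {Owner, Item, Agent} \<longrightarrow> s1 a = s a" using 4 by (simp add: same_def)
  have own1: "\<forall>c\<in>{1..m}. if c < k \<and> s Owner c = 0
          then \<exists>j\<in>L. zero j c \<and> s1 Owner c = int j else s1 Owner c = s Owner c"
    using 4 by blast
  have s1k: "s1 Owner k = s Owner k" using own1 k by simp
  have "s Owner k \<in> int ` {0..n}" using r k unfolding ready_def by blast
  then have unassigned: "s Owner k < 1 \<longleftrightarrow> s Owner k = 0" by auto
  have "run (Cond (Less (Cell Owner (Var Item)) (Const 1))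
     (For Agent 0 (Cond (Conj (Less (Cell Dropped (Var Agent)) (Const 1)) is_zero)
       (Store Owner (Var Item) (Var Agent)) Skip))
     Skip) s1 (n * 35 + 17) J"
  proof (rule run_Cond[where T = "n * 35 + 11"])
    assume "\<not> holds (Less (Cell Owner (Var Item)) (Const 1)) s1"
    then have "s Owner k \<noteq> 0" using 4(4) s1k by simp
    then have "J s1" using 4(3,4) own1 by (auto simp: J_def less_Suc_eq)
    then show "run Skip s1 (n * 35 + 11) J" by (intro run_Skip) auto
  next
    assume "holds (Less (Cell Owner (Var Item)) (Const 1)) s1"
    then have z: "s Owner k = 0" using 4(4) s1k unassigned by simp
    have "k \<notin> pend (s Owner) L" using r by (simp add: ready_def)
    then have "\<exists>j\<in>L. zero j k" using k z by (simp add: pend_def)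
    \<comment> \<open>This agent guarantees success of the inner scan: once the scan is past
      \<open>j0\<close>, the item has an owner in \<open>L\<close> for whom it is free. A later
      suitable agent may overwrite that owner.\<close>
    then obtain j0 where j0: "j0 \<in> L" "zero j0 k" "j0 \<in> {1..n}"
      using r unfolding ready_def by blast
    show "run (For Agent 0 (Cond (Conj (Less (Cell Dropped (Var Agent)) (Const 1)) is_zero)
       (Store Owner (Var Item) (Var Agent)) Skip)) s1 (n * 35 + 11) J"
    proof (rule run_For[where N = n and T = 21 and
          I = "\<lambda>i s'. same {Owner, Agent} s1 s' \<and>
            (\<forall>c. c \<noteq> k \<longrightarrow> s' Owner c = s1 Owner c) \<and>
            (j0 < i \<longrightarrow> (\<exists>j\<in>L. zero j k \<and> s' Owner k = int j))"], goal_cases)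
      case 1
      then show ?case using j0 by (simp add: same_def)
    next
      case (2 i s2 y)
      then show ?case by (simp add: same_def)
    next
      case (3 i s2)
      then show ?case using r fr1 by (simp add: same_def ready_def input_ok_def)
    next
      case (4 i s2)
      have fr2: "\<forall>a. a \<notin> {Owner, Agent} \<longrightarrow> s2 a = s1 a" using 4 by (simp add: same_def)
      have i: "i \<in> {1..n}" using 4 by simp
      have hz: "holds is_zero s2 \<longleftrightarrow> zero i k"
        by (rule holds_is_zero)
          (use fr1 fr2 r 4(4) \<open>s1 Item 0 = int k\<close> i k in \<open>simp_all add: ready_def\<close>)
      have hd: "s2 Dropped i < 1 \<longleftrightarrow> i \<in> L"
        using fr1 fr2 r i by (simp add: ready_def flags_def)
      have it: "s2 Item 0 = int k" using fr2 \<open>s1 Item 0 = int k\<close> by simp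
      show ?case
      proof (rule run_Cond[where T = 5])
        assume "holds (Conj (Less (Cell Dropped (Var Agent)) (Const 1)) is_zero) s2"
        then have "i \<in> L" "zero i k" using hz hd 4(4) by simp_all
        then show "run (Store Owner (Var Item) (Var Agent)) s2 5 (\<lambda>s'. s' Agent 0 = int i \<and>
            same {Owner, Agent} s1 s' \<and> (\<forall>c. c \<noteq> k \<longrightarrow> s' Owner c = s1 Owner c) \<and>
            (j0 < Suc i \<longrightarrow> (\<exists>j\<in>L. zero j k \<and> s' Owner k = int j)))"
          using 4 it by (intro run_Store) (auto simp: same_def)
      next
        assume "\<not> holds (Conj (Less (Cell Dropped (Var Agent)) (Const 1)) is_zero) s2"
        then have "i \<noteq> j0" using hz hd 4(4) j0 by auto
        then show "run Skip s2 5 (\<lambda>s'. s' Agent 0 = int i \<and>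
            same {Owner, Agent} s1 s' \<and> (\<forall>c. c \<noteq> k \<longrightarrow> s' Owner c = s1 Owner c) \<and>
            (j0 < Suc i \<longrightarrow> (\<exists>j\<in>L. zero j k \<and> s' Owner k = int j)))"
          using 4 by (intro run_Skip) (auto simp: less_Suc_eq)
      qed (simp add: test_cost_is_zero)
    next
      case (5 s2)
      have fr2: "\<forall>a. a \<notin> {Owner, Agent} \<longrightarrow> s2 a = s1 a" using 5 by (simp add: same_def)
      have new: "\<exists>j\<in>L. zero j k \<and> s2 Owner k = int j" using 5 j0 by simp
      have old: "\<forall>c. c \<noteq> k \<longrightarrow> s2 Owner c = s1 Owner c" using 5 by blast
      have "if c < Suc k \<and> s Owner c = 0
          then \<exists>j\<in>L. zero j c \<and> s2 Owner c = int j else s2 Owner c = s Owner c"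
        if c: "c \<in> {1..m}" for c
      proof (cases "c = k")
        case True
        then show ?thesis using new z by simp
      next
        case False
        then have "c < Suc k \<longleftrightarrow> c < k" by auto
        then show ?thesis using False old own1 c by simp
      qed
      moreover have "same {Owner, Item, Agent} s s2" using fr1 fr2 by (simp add: same_def)
      moreover have "s2 Item 0 = int k" using fr2 \<open>s1 Item 0 = int k\<close> by simp
      ultimately show ?case unfolding J_def by blast
    qed simp
  qed simp
  then show ?case unfolding J_def .
next
  case (5 s1)
  have "complete_by L (s Owner) (s1 Owner)"
    unfolding complete_by_def
  proof
    fix c assume c: "c \<in> {1..m}"
    then have "if c < Suc m \<and> s Owner c = 0
          then \<exists>j\<in>L. zero j c \<and> s1 Owner c = int j else s1 Owner c = s Owner c"
      using 5 by blast
    then show "if s Owner c \<noteq> 0 then s1 Owner c = s Owner c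
        else \<exists>j\<in>L. zero j c \<and> s1 Owner c = int j"
      using c by (cases "s Owner c = 0") auto
  qed
  then show ?case using r unfolding ready_def by blast
next
  case 6
  then show ?case using time by (simp add: add.commute)
qed

section \<open>Reading the input\<close>

lemma length_encode: "length (encode_instance n m v) = 2 + n * m"
proof -
  have "length (concat (map (\<lambda>i. map (\<lambda>c. \<lfloor>v i {c}\<rfloor>) [1..<Suc m]) [1..<Suc k])) = k * m" for k
    by (induction k) (auto simp: algebra_simps)
  then show ?thesis by (simp add: encode_instance_def)
qed

lemma nth_concat_rows:
  "\<forall>xs\<in>set xss. length xs = w \<Longrightarrow> i < length xss \<Longrightarrow> c < w \<Longrightarrow>
   concat xss ! (i * w + c) = xss ! i ! c"
proof (induction xss arbitrary: i)
  case (Cons xs xss)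
  then show ?case by (cases i) (simp_all add: nth_append)
qed simp

lemma nth_encode:
  assumes "i < n" "c < m"
  shows "encode_instance n m v ! (2 + (i * m + c)) = (if zero (Suc i) (Suc c) then 0 else -1)"
proof -
  have "v (Suc i) {Suc c} \<in> {0, -1}"
    using binary assms unfolding binary_chores_instance_def by simp
  then have val: "\<lfloor>v (Suc i) {Suc c}\<rfloor> = (if zero (Suc i) (Suc c) then 0 else -1)"
    using floor_of_int[of "-1", where 'a = real] by (auto simp: zero_def)
  have "encode_instance n m v ! (2 + (i * m + c)) =
      concat (map (\<lambda>i. map (\<lambda>c. \<lfloor>v i {c}\<rfloor>) [1..<Suc m]) [1..<Suc n]) ! (i * m + c)"
    by (simp add: encode_instance_def)
  also have "\<dots> = map (\<lambda>i. map (\<lambda>c. \<lfloor>v i {c}\<rfloor>) [1..<Suc m]) [1..<Suc n] ! i ! c"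
    by (rule nth_concat_rows) (use assms in auto)
  also have "\<dots> = \<lfloor>v (Suc i) {Suc c}\<rfloor>"
    using assms by (simp add: plus_1_eq_Suc del: upt_Suc)
  finally show ?thesis using val by simp
qed

definition start :: memory where
  "start = initial_memory (encode_instance n m v)"

lemma start_simps:
  "start 0 0 = int n" "start 0 1 = int m" "a \<noteq> 0 \<Longrightarrow> start a k = 0"
  by (simp_all add: start_def initial_memory_def encode_instance_def)

text \<open>In the row-major matrix behind the two header cells, the entry of agent \<open>i\<close>
  and item \<open>c\<close> has position \<open>2 + (i - 1) * m + (c - 1)\<close>. The length bound
  is needed since \<open>initial_memory\<close> is 0 beyond the list.\<close>

lemma start_matrix:
  assumes "i \<in> {1..n}" "c \<in> {1..m}"
  shows "start 0 (nat (1 + (int i - 1) * int m + int c)) = (if zero i c then 0 else -1)"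
proof -
  obtain i' c' where ic: "i = Suc i'" "c = Suc c'" "i' < n" "c' < m"
    using assms by (cases i; cases c) auto
  have "i' * m + c' < Suc i' * m" using ic(4) by simp
  also have "\<dots> \<le> n * m" using ic(3) by (intro mult_right_mono) auto
  finally have lt: "2 + (i' * m + c') < length (encode_instance n m v)" by (simp add: length_encode)
  have "1 + (int i - 1) * int m + int c = int (2 + (i' * m + c'))"
    using ic by simp
  then have "nat (1 + (int i - 1) * int m + int c) = 2 + (i' * m + c')"
    by (metis nat_int)
  then show ?thesis
    using lt nth_encode[OF ic(3,4)] ic by (simp add: start_def initial_memory_def)
qed

lemma run_set_rows:
  assumes "n * 25 + 17 \<le> T"
  shows "run set_rows start T (\<lambda>s'. same {Row, Agent} start s' \<and> input_ok (s' 0) (s' Row))"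
  unfolding set_rows_def
proof (rule run_Store_Seq)
  have ok: "input_ok (s' 0) (s' Row)"
    if "same {Row, Agent} start s'" "\<forall>i\<in>{0..<Suc n}. s' Row i = 1 + (int i - 1) * int m" for s'
  proof -
    have "s' 0 = start 0" using that(1) by (simp add: same_def)
    moreover have "s' Row i = 1 + (int i - 1) * int m" if "i \<in> {1..n}" for i
      using \<open>\<forall>i\<in>{0..<Suc n}. _\<close> that by simp
    ultimately show ?thesis using start_simps start_matrix unfolding input_ok_def by auto
  qed
  show "run (For Agent 0 (Store Row (Var Agent)
        (Add (Cell Row (Sub (Var Agent) (Const 1))) num_items)))
     (start(Row := (start Row)(nat (eval (Const 0) start) := eval (Sub (Const 1) num_items) start)))
     (T - (1 + expr_cost (Const 0) + expr_cost (Sub (Const 1) num_items)))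
     (\<lambda>s'. same {Row, Agent} start s' \<and> input_ok (s' 0) (s' Row))"
  \<comment> \<open>The invariant covers index 0 as well: \<open>Row[0] = 1 - m\<close> is the
    offset of a fictitious row before the matrix, from which the recurrence starts.\<close>
  proof (rule run_For[where N = n and T = 11 and
        I = "\<lambda>k s'. same {Row, Agent} start s' \<and>
          (\<forall>i\<in>{0..<k}. s' Row i = 1 + (int i - 1) * int m)"], goal_cases)
    case 1
    have "{0..<1::nat} = {0}" by auto
    then show ?case using start_simps(2) by (simp add: same_def start_simps One_nat_def)
  next
    case (2 k s1 y)
    then show ?case by (simp add: same_def)
  next
    case (3 k s1)
    then show ?case by (simp add: same_def start_simps)
  next
    case (4 k s1)
    have "s1 Row (k - 1) = 1 + (int (k - 1) - 1) * int m" using 4 by simp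
    moreover have "nat (int k - 1) = k - 1" "int (k - 1) - 1 = int k - 2"
      using 4(1) by linarith+
    ultimately have prev: "s1 Row (nat (int k - 1)) = 1 + (int k - 2) * int m"
      by metis
    have now: "s1 Row (nat (int k - 1)) + int m = 1 + (int k - 1) * int m"
      unfolding prev by (simp add: algebra_simps)
    show ?case
      by (intro run_Store)
        (use 4 now start_simps(2) in \<open>simp_all add: same_def atLeastLessThanSuc One_nat_def\<close>)
  next
    case (5 s1)
    then show ?case using ok by blast
  next
    case 6
    then show ?case using assms by simp
  qed
qed (use assms in simp)

lemma run_covers:
  assumes ok: "input_ok (s 0) (s Row)" and z: "\<forall>c. s Cover c = 0"
    and time: "n * (m * 32 + 25) + 11 \<le> T"
  shows "run (For Agent 0 (adjust 1)) s T (\<lambda>s'. same {Cover, Item, Agent} s s' \<and>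
    cover {1..n} (s' Cover))"
proof (rule run_For[where N = n and T = "m * 32 + 11" and
      I = "\<lambda>k s'. same {Cover, Item, Agent} s s' \<and> cover {1..<k} (s' Cover)"], goal_cases)
  case 1
  then show ?case using z by (simp add: same_def cover_def)
next
  case (2 k s1 y)
  then show ?case by (simp add: same_def)
next
  case (3 k s1)
  then show ?case using ok by (simp add: same_def input_ok_def)
next
  case (4 k s1)
  have fr: "\<forall>a. a \<notin> {Cover, Item, Agent} \<longrightarrow> s1 a = s a" using 4 by (simp add: same_def)
  have "run (adjust 1) s1 (m * 32 + 11) (\<lambda>s'. same {Cover, Item} s1 s' \<and>
    (\<forall>c\<in>{1..m}. s' Cover c = s1 Cover c + (if zero k c then 1 else 0)))"
    by (rule run_adjust) (use 4 fr ok in auto)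
  then show ?case
  proof (rule run_conseq)
    fix s2 assume s2: "same {Cover, Item} s1 s2 \<and>
      (\<forall>c\<in>{1..m}. s2 Cover c = s1 Cover c + (if zero k c then 1 else 0))"
    have "cover {1..<Suc k} (s2 Cover)"
      unfolding cover_def
    proof
      fix c assume c: "c \<in> {1..m}"
      have "{i \<in> {1..<Suc k}. zero i c} = {i \<in> {1..<k}. zero i c} \<union> (if zero k c then {k} else {})"
        using 4(1) by (auto simp: less_Suc_eq)
      then show "s2 Cover c = int (card {i \<in> {1..<Suc k}. zero i c})"
        using s2 c 4(3) by (simp add: cover_def)
    qed
    then show "s2 Agent 0 = int k \<and> same {Cover, Item, Agent} s s2 \<and> cover {1..<Suc k} (s2 Cover)"
      using 4 s2 by (simp add: same_def)
  qed simp
next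
  case (5 s1)
  then show ?case by (simp add: atLeastLessThanSuc_atLeastAtMost)
next
  case 6
  then show ?case using time by (simp add: add.commute)
qed

section \<open>Assembling the program and its running time\<close>

lemma run_passes:
  assumes d: "dropping q {1..n} s"
    and time: "(n * (m * 98 + 90) + 11) + ((n * (m * 30 + 55) + 11) +
      ((m * 32 + n * (m * 30 + 36) + 31) + (m * (n * 35 + 31) + 11))) \<le> T"
  shows "run passes s T (\<lambda>s'. solution (s' Owner))"
  unfolding passes_def
proof (rule run_Seq[OF run_drop_pass[OF d order_refl] _ time])
  fix s1 assume "\<exists>L. dropping q L s1 \<and>
    (0 < s1 Pending 0 \<longrightarrow> (\<forall>i\<in>L. s1 Gap 0 \<le> int (card (sole L i))))"
  then obtain L where L: "dropping q L s1"
    "0 < s1 Pending 0 \<longrightarrow> (\<forall>i\<in>L. s1 Gap 0 \<le> int (card (sole L i)))" by blast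
  \<comment> \<open>With nobody served, the old invariant yields the new one, with \<open>g\<close>
    frozen at the current value of \<open>Gap\<close>.\<close>
  have sv: "serving q L (s1 Gap 0) {} s1"
    using L(1) by (simp add: dropping_def serving_def)
  show "run (Seq serve_pass (Seq star_pass final_pass)) s1 ((n * (m * 30 + 55) + 11) +
      ((m * 32 + n * (m * 30 + 36) + 31) + (m * (n * 35 + 31) + 11)))
      (\<lambda>s'. solution (s' Owner))"
  proof (rule run_Seq[OF run_serve_pass[OF sv L(2) order_refl] _ order_refl])
    fix s2 assume "\<exists>G. serving q L (s1 Gap 0) G s2 \<and> s2 Pending 0 = 0 \<and>
      (G \<noteq> {} \<longrightarrow> (\<forall>i\<in>L. s1 Gap 0 \<le> int (card (sole L i))))"
    then obtain G where "serving q L (s1 Gap 0) G s2" "s2 Pending 0 = 0"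
      "G \<noteq> {} \<longrightarrow> (\<forall>i\<in>L. s1 Gap 0 \<le> int (card (sole L i)))" by blast
    from run_star_pass[OF this order_refl]
    show "run (Seq star_pass final_pass) s2
      ((m * 32 + n * (m * 30 + 36) + 31) + (m * (n * 35 + 31) + 11))
      (\<lambda>s'. solution (s' Owner))"
      by (rule run_Seq[OF _ run_final_pass[OF _ order_refl] order_refl])
  qed
qed

lemma run_allocate:
  assumes ok: "input_ok (s 0) (s Row)" and cov: "cover {1..n} (s Cover)"
    and z: "\<And>k. s Owner k = 0" "\<And>k. s Dropped k = 0" "\<And>k. s Served k = 0" "s Star 0 = 0"
    and e: "s Pending 0 = int (card {c \<in> {1..m}. \<forall>i\<in>{1..n}. \<not> zero i c})"
    and time: "(m * (n * (m * 30 + 30) + 38) + 11) + (7 + ((n * (m * 98 + 90) + 11) +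
      ((n * (m * 30 + 55) + 11) +
      ((m * 32 + n * (m * 30 + 36) + 31) + (m * (n * 35 + 31) + 11))))) \<le> T"
  shows "run allocate s T (\<lambda>s'. solution (s' Owner))"
proof -
  have p: "partial 0 {1..n} {} (s Owner)"
    by (auto simp: partial_def z share_def)
  have "pend (s Owner) {1..n} = {c \<in> {1..m}. \<forall>i\<in>{1..n}. \<not> zero i c}"
    by (simp add: pend_def z)
  then have e': "s Pending 0 = int (card (pend (s Owner) {1..n}))"
    using e by simp
  show ?thesis
    unfolding allocate_def
  proof (rule run_Seq[OF run_rounds[OF ok cov p e' order_refl] _ time])
    fix s1 assume s1: "same {Owner, Pick, Item, Agent, Pending, Round} s s1 \<and>
      (\<exists>q. partial q {1..n} {} (s1 Owner)) \<and>
      s1 Pending 0 = int (card (pend (s1 Owner) {1..n})) \<and> s1 Pending 0 < int n"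
    then obtain q where q: "partial q {1..n} {} (s1 Owner)" by blast
    have fr: "\<forall>a. a \<notin> {Owner, Pick, Item, Agent, Pending, Round} \<longrightarrow> s1 a = s a"
      using s1 by (simp add: same_def)
    \<comment> \<open>The new \<open>Gap\<close> is positive because the rounds leave fewer than
      \<open>n\<close> pending items.\<close>
    have d: "dropping q {1..n} (s1(Gap := (s1 Gap)(0 := int n - s1 Pending 0)))"
      using fr q s1 cov ok z by (simp add: dropping_def flags_def)
    have "s1 0 0 = int n" using fr ok by (simp add: input_ok_def)
    then show "run (Seq (Assign Gap (Sub num_agents (Var Pending))) passes) s1
      (7 + ((n * (m * 98 + 90) + 11) + ((n * (m * 30 + 55) + 11) +
      ((m * 32 + n * (m * 30 + 36) + 31) + (m * (n * 35 + 31) + 11)))))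
      (\<lambda>s'. solution (s' Owner))"
      by (intro run_Store_Seq) (use run_passes[OF d order_refl] in simp_all)
  qed
qed

lemma solution_no_items:
  assumes "m = 0"
  shows "solution a"
proof (rule solutionI)
  fix i assume "i \<in> {1..n}"
  have "{1..m} = {}" using assms by simp
  then have "share a i = {}" unfolding share_def by blast
  then show "\<exists>t. (\<forall>c\<in>share a i. cost i (share a i - {c}) \<le> t) \<and>
      (\<forall>j\<in>{1..n}. t \<le> cost i (share a j) \<and> t \<le> cost j (share a j))"
    by (intro exI[of _ 0]) simp
qed (use assms in simp)

text \<open>A constant number of steps; 150 is the constant coefficient of the final polynomial, so
  this bound fits for every \<open>n\<close>.\<close>

lemma run_no_items:
  assumes "m = 0"
  shows "run chores_program start 150 (\<lambda>s'. solution (s' Owner))"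
  unfolding chores_program_def
proof (rule run_Cond[where T = 1])
  assume "holds (Less (Const 0) num_items) start"
  then show "run (Seq set_rows (Seq (For Agent 0 (adjust 1))
       (Seq (count (Less (Cell Cover (Var Item)) (Const 1)))
       (Seq (Assign Pending (Var Num)) allocate)))) start 1 (\<lambda>s'. solution (s' Owner))"
    using start_simps(2) assms by (simp add: One_nat_def)
qed (auto intro: run_Skip solution_no_items[OF assms])

text \<open>The collected budgets of all parts, rounded up. The cubic term comes from the rounds: up
  to \<open>m\<close> rounds of \<open>n\<close> agents, each scanning \<open>m\<close>
  items.\<close>

definition time_bound :: nat where
  "time_bound = m * (n * (m * 30)) + n * (m * 285) + n * 231 + m * 127 + 150"

lemma run_items:
  assumes "1 \<le> m"
  shows "run chores_program start time_bound (\<lambda>s'. solution (s' Owner))"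
proof -
  let ?A = "(m * (n * (m * 30 + 30) + 38) + 11) + (7 + ((n * (m * 98 + 90) + 11) +
      ((n * (m * 30 + 55) + 11) +
      ((m * 32 + n * (m * 30 + 36) + 31) + (m * (n * 35 + 31) + 11)))))"
  let ?T3 = "4 + ?A" and ?R = "\<lambda>s'. solution (s' Owner)"
  let ?T2 = "(m * 26 + 14) + ?T3"
  let ?T1 = "(n * (m * 32 + 25) + 11) + ?T2"
  let ?T0 = "(n * 25 + 17) + ?T1"
  have time: "1 + test_cost (Less (Const 0) num_items) + ?T0 \<le> time_bound"
    by (simp add: time_bound_def algebra_simps)
  show ?thesis
    unfolding chores_program_def
  proof (rule run_Cond[OF _ _ time])
    assume "\<not> holds (Less (Const 0) num_items) start"
    then show "run Skip start ?T0 ?R"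
      using start_simps(2) assms by (simp add: One_nat_def)
  next
    show "run (Seq set_rows (Seq (For Agent 0 (adjust 1))
       (Seq (count (Less (Cell Cover (Var Item)) (Const 1)))
       (Seq (Assign Pending (Var Num)) allocate)))) start ?T0 ?R"
    proof (rule run_Seq[OF run_set_rows[OF order_refl] _ order_refl])
      fix s1 assume "same {Row, Agent} start s1 \<and> input_ok (s1 0) (s1 Row)"
      then have ok1: "input_ok (s1 0) (s1 Row)"
        and z1: "\<And>a k. a \<notin> {0, Row, Agent} \<Longrightarrow> s1 a k = 0"
        by (auto simp: same_def start_simps)
      show "run (Seq (For Agent 0 (adjust 1))
         (Seq (count (Less (Cell Cover (Var Item)) (Const 1)))
         (Seq (Assign Pending (Var Num)) allocate))) s1 ?T1 ?R"
      proof (rule run_Seq[OF run_covers[OF ok1 _ order_refl] _ order_refl])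
        show "\<forall>c. s1 Cover c = 0" using z1 by simp
        fix s2 assume s2: "same {Cover, Item, Agent} s1 s2 \<and> cover {1..n} (s2 Cover)"
        have fr2: "\<forall>a. a \<notin> {Cover, Item, Agent} \<longrightarrow> s2 a = s1 a"
          using s2 by (simp add: same_def)
        have "run (count (Less (Cell Cover (Var Item)) (Const 1))) s2 (m * 26 + 14)
          (\<lambda>s'. same {Num, Item} s2 s' \<and>
            s' Num 0 = int (card {c \<in> {1..m}. \<forall>i\<in>{1..n}. \<not> zero i c}))"
        proof (rule run_count)
          show "s2 0 1 = int m" using ok1 fr2 by (simp add: input_ok_def)
          fix s' c assume c: "c \<in> {1..m}" "same {Num, Item} s2 s'" "s' Item 0 = int c"
          then show "holds (Less (Cell Cover (Var Item)) (Const 1)) s' \<longleftrightarrow>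
              (\<forall>i\<in>{1..n}. \<not> zero i c)"
            using cover_less_1[of "{1..n}" "s2 Cover" c] s2 by (simp add: same_def)
        qed simp
        then show "run (Seq (count (Less (Cell Cover (Var Item)) (Const 1)))
           (Seq (Assign Pending (Var Num)) allocate)) s2 ?T2 ?R"
        proof (rule run_Seq[OF _ _ order_refl])
          fix s3 assume s3: "same {Num, Item} s2 s3 \<and>
            s3 Num 0 = int (card {c \<in> {1..m}. \<forall>i\<in>{1..n}. \<not> zero i c})"
          have fr3: "\<forall>a. a \<notin> {Num, Item} \<longrightarrow> s3 a = s2 a" using s3 by (simp add: same_def)
          have "run allocate (s3(Pending := (s3 Pending)(0 := s3 Num 0))) ?A ?R"
            by (rule run_allocate[OF _ _ _ _ _ _ _ order_refl])
              (use fr3 fr2 s2 s3 ok1 z1 in simp_all)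
          then show "run (Seq (Assign Pending (Var Num)) allocate) s3 ?T3 ?R"
            by (intro run_Store_Seq) simp_all
        qed
      qed
    qed
  qed
qed

lemma output_allocation_eq: "output_allocation m s = share (s Owner)"
  by (auto simp: output_allocation_def share_def fun_eq_iff)

lemma length_le_bit_size: "length xs \<le> bit_size xs"
  by (induction xs) (auto simp: bit_size_def)

text \<open>With an item present, both \<open>n\<close> and \<open>m\<close> are at most
  \<open>n * m\<close> and so at most the input length. Without items the matrix is empty and
  \<open>n\<close> may exceed the bit size. The linear coefficient 358 is 231 + 127.\<close>

lemma time_bound_le: "time_bound \<le> poly [:150, 358, 285, 30:] (bit_size (encode_instance n m v))"
  if "m \<ge> 1"
proof -
  define B where "B = bit_size (encode_instance n m v)"
  have nm: "2 + n * m \<le> B"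
    using length_le_bit_size[of "encode_instance n m v"] by (simp add: B_def length_encode)
  have "n * 1 \<le> n * m" "1 * m \<le> n * m" by (intro mult_le_mono order_refl that n_pos)+
  then have B: "n \<le> B" "m \<le> B" using nm by linarith+
  have "m * (n * (m * 30)) \<le> B * (B * (B * 30))" "n * (m * 285) \<le> B * (B * 285)"
    "n * 231 \<le> B * 231" "m * 127 \<le> B * 127"
    using B by (intro mult_le_mono; simp)+
  then have "time_bound \<le> B * (B * (B * 30)) + B * (B * 285) + B * 231 + B * 127 + 150"
    unfolding time_bound_def by linarith
  also have "\<dots> = poly [:150, 358, 285, 30:] B" by (simp add: algebra_simps)
  finally show ?thesis by (simp add: B_def)
qed

lemma run_chores_program:
  "run chores_program start (poly [:150, 358, 285, 30:] (bit_size (encode_instance n m v)))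
    (\<lambda>s'. solution (s' Owner))"
proof (cases "m = 0")
  case True
  show ?thesis by (rule run_conseq[OF run_no_items[OF True]]) auto
next
  case False
  then have "1 \<le> m" by simp
  show ?thesis
    by (rule run_conseq[OF run_items time_bound_le]) fact+
qed

lemma ex_exec_chores_program:
  "\<exists>t s. exec chores_program (initial_memory (encode_instance n m v)) t s \<and>
    t \<le> poly [:150, 358, 285, 30:] (bit_size (encode_instance n m v)) \<and>
    allocation n {1..m} (output_allocation m s) \<and>
    EFX n v (output_allocation m s) \<and> EQX n v (output_allocation m s)"
  using run_chores_program by (simp only: run_def start_def solution_def output_allocation_eq)

lemma ex_solution: "\<exists>a. solution a"
proof -
  have "\<exists>t s. exec chores_program start t s \<and>
      t \<le> poly [:150, 358, 285, 30:] (bit_size (encode_instance n m v)) \<and> solution (s Owner)"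
    using run_chores_program by (simp only: run_def)
  then show ?thesis by (elim exE conjE) (rule exI)
qed

end

section \<open>Arbitrary item sets\<close>

text \<open>Items are numbered by a bijection \<open>h\<close>, the valuations are pulled back along
  it, and the bundles computed for the numbered instance are mapped forward again.\<close>

lemma ex_efx_eqx_allocation:
  fixes M :: "'a set"
  assumes inst: "binary_chores_instance n M v"
  shows "\<exists>A. allocation n M A \<and> EFX n v A \<and> EQX n v A"
proof -
  have fin: "finite M" using inst by (simp add: binary_chores_instance_def chores_instance_def)
  obtain h where h: "bij_betw h {1..card M} M"
    using ex_bij_betw_nat_finite_1[OF fin] by blast
  have inj: "inj_on h {1..card M}" and img: "h ` {1..card M} = M"
    using h by (auto simp: bij_betw_def)
  define v' where "v' i S = v i (h ` S)" for i S
  have "additive_valuation {1..card M} (v' i)" if "i \<in> {1..n}" for i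
    unfolding additive_valuation_def
  proof (intro conjI allI impI)
    have add: "v i {} = 0" "\<And>S. S \<subseteq> M \<Longrightarrow> v i S = (\<Sum>c\<in>S. v i {c})"
      using inst that
      unfolding binary_chores_instance_def chores_instance_def additive_valuation_def by blast+
    show "v' i {} = 0" using add(1) by (simp add: v'_def)
    fix S assume S: "S \<subseteq> {1..card M}"
    have "v' i S = (\<Sum>c\<in>h ` S. v i {c})" unfolding v'_def by (rule add(2)) (use S img in auto)
    also have "\<dots> = (\<Sum>c\<in>S. v' i {c})"
      using inj_on_subset[OF inj S] by (simp add: sum.reindex v'_def)
    finally show "v' i S = (\<Sum>c\<in>S. v' i {c})" .
  qed
  moreover have "h c \<in> M" if "c \<in> {1..card M}" for c using img that by auto
  ultimately have "binary_chores_instance n {1..card M} v'"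
    using inst by (simp add: binary_chores_instance_def chores_instance_def v'_def)
  then interpret binary_chores n "card M" v' by unfold_locales
  obtain a where "solution a" using ex_solution by (elim exE)
  then have sol: "allocation n {1..card M} (share a)" "EFX n v' (share a)" "EQX n v' (share a)"
    by (simp_all add: solution_def)
  have sub: "share a i \<subseteq> {1..card M}" for i by (auto simp: share_def)
  define A where "A i = h ` share a i" for i
  have alloc: "allocation n M A"
    unfolding allocation_def
  proof (intro conjI ballI impI)
    fix i j assume "i \<in> {1..n}" "j \<in> {1..n}" "i \<noteq> j"
    then have "share a i \<inter> share a j = {}" using sol(1) unfolding allocation_def by blast
    then show "A i \<inter> A j = {}"
      unfolding A_def using inj_on_image_Int[OF inj sub[of i] sub[of j]] by simp
  next
    have "(\<Union>i\<in>{1..n}. share a i) = {1..card M}" using sol(1) unfolding allocation_def by blast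
    then show "(\<Union>i\<in>{1..n}. A i) = M" unfolding A_def using img by (metis image_UN)
  qed
  have "v i (A j) = v' i (share a j)" "v i (A i - {h c}) = v' i (share a i - {c})"
    if "c \<in> share a i" for i j c
  proof -
    show "v i (A j) = v' i (share a j)" by (simp add: A_def v'_def)
    \<comment> \<open>Injectivity ensures that deleting one item commutes with taking
      images.\<close>
    have "h d \<noteq> h c" if "d \<in> share a i" "d \<noteq> c" for d
      using inj_onD[OF inj] sub that \<open>c \<in> share a i\<close> by blast
    then have "h ` (share a i - {c}) = A i - {h c}" unfolding A_def by auto
    then show "v i (A i - {h c}) = v' i (share a i - {c})" by (simp add: v'_def)
  qed
  note val = this
  have "EFX n v A"
    unfolding EFX_def
  proof (intro ballI impI)
    fix i j c assume ij: "i \<in> {1..n}" "j \<in> {1..n}" and "c \<in> A i"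
    then obtain d where d: "d \<in> share a i" "c = h d" by (auto simp: A_def)
    then have "v' i (share a j) \<le> v' i (share a i - {d})"
      using sol(2) ij unfolding EFX_def by blast
    then show "v i (A j) \<le> v i (A i - {c})" using val[OF d(1)] d(2) by simp
  qed
  moreover have "EQX n v A"
    unfolding EQX_def
  proof (intro ballI impI)
    fix i j c assume ij: "i \<in> {1..n}" "j \<in> {1..n}" and "c \<in> A i"
    then obtain d where d: "d \<in> share a i" "c = h d" by (auto simp: A_def)
    then have "v' j (share a j) \<le> v' i (share a i - {d})"
      using sol(3) ij unfolding EQX_def by blast
    moreover have "v j (A j) = v' j (share a j)" by (simp add: A_def v'_def)
    ultimately show "v j (A j) \<le> v i (A i - {c})" using val(2)[OF d(1)] d(2) by simp
  qed
  ultimately show ?thesis using alloc by blast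
qed

theorem theorem6:
  shows "(\<forall>(n::nat) (M::'a set) v. binary_chores_instance n M v \<longrightarrow>
            (\<exists>A. allocation n M A \<and> EFX n v A \<and> EQX n v A)) \<and>
         (\<exists>(P::program) (p::nat poly).
            \<forall>(n::nat) (m::nat) v. binary_chores_instance n {1..m} v \<longrightarrow>
              (\<exists>t s. exec P (initial_memory (encode_instance n m v)) t s \<and>
                 t \<le> poly p (bit_size (encode_instance n m v)) \<and>
                 allocation n {1..m} (output_allocation m s) \<and>
                 EFX n v (output_allocation m s) \<and>
                 EQX n v (output_allocation m s)))"
proof (intro conjI allI impI exI[of _ chores_program] exI[of _ "[:150, 358, 285, 30:]"])
  show "\<exists>A. allocation n M A \<and> EFX n v A \<and> EQX n v A"
    if "binary_chores_instance n M v" for n and M :: "'a set" and v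
    by (rule ex_efx_eqx_allocation[OF that])
next
  fix n m :: nat and v assume "binary_chores_instance n {1..m} v"
  then interpret binary_chores n m v by unfold_locales
  show "\<exists>t s. exec chores_program (initial_memory (encode_instance n m v)) t s \<and>
      t \<le> poly [:150, 358, 285, 30:] (bit_size (encode_instance n m v)) \<and>
      allocation n {1..m} (output_allocation m s) \<and>
      EFX n v (output_allocation m s) \<and> EQX n v (output_allocation m s)"
    by (rule ex_exec_chores_program)
qed

end
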